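(* Let $H_1,H_2$ be graphs such that $H_1$ is a vertex-minor of $H_2$, and let $\alpha\geq 2$. If $\text{Exact-Weight-}H_2$ can be solved in time $O(n^\alpha)$ on graphs with $n$ nodes, then $\text{Exact-Weight-}H_1$ can be solved in time $\tilde O(n^\alpha)$.
   Context: For a fixed graph $H$, $\text{Exact-Weight-}H$: given a graph $G$ with integer edge weights and a target integer $t$, decide whether $G$ contains a (not necessarily induced) subgraph isomorphic to $H$ whose edge weights sum to $t$. A graph $H_1$ is a vertex-minor of $H_2$ if there is a sequence of graphs $H^{(1)}=H_1,\dots,H^{(\ell)}=H_2$ such that for each $i\in[\ell-1]$, $H^{(i)}$ is obtained from $H^{(i+1)}$ either by deleting a single edge, or by contracting two (not necessarily adjacent) nodes $h_j,h_k$ of $H^{(i+1)}$ into a single node $h_{jk}$ with $N(h_{jk})=N(h_j)\cup N(h_k)$, where $N(\cdot)$ denotes the neighborhood. $\tilde O$ hides polylogarithmic factors in $n$; the size of the fixed graphs is treated as a constant. *)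

theory Defs
  imports Complex_Main "HOL-Library.Landau_Symbols"
begin

section \<open>Finite simple graphs\<close>

type_synonym 'a graph = "'a set \<times> 'a set set"

abbreviation verts :: "'a graph \<Rightarrow> 'a set" where "verts \<equiv> fst"
abbreviation edges :: "'a graph \<Rightarrow> 'a set set" where "edges \<equiv> snd"

definition simple_graph :: "'a graph \<Rightarrow> bool" where
  "simple_graph G \<longleftrightarrow> finite (verts G) \<and> (\<forall>e\<in>edges G. e \<subseteq> verts G \<and> card e = 2)"

definition neighborhood :: "'a graph \<Rightarrow> 'a \<Rightarrow> 'a set" where
  "neighborhood G v = {u. {u, v} \<in> edges G}"

definition subgraph_of :: "'a graph \<Rightarrow> 'a graph \<Rightarrow> bool" where
  "subgraph_of S G \<longleftrightarrow> simple_graph S \<and> verts S \<subseteq> verts G \<and> edges S \<subseteq> edges G"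

definition graph_iso :: "'a graph \<Rightarrow> 'b graph \<Rightarrow> bool" where
  "graph_iso G H \<longleftrightarrow>
     (\<exists>f. bij_betw f (verts G) (verts H) \<and> edges H = (\<lambda>e. f ` e) ` edges G)"


section \<open>Vertex-minors\<close>

text \<open>
  The nodes a and b are replaced by one node c, which may be a new name or one of a and b. The
  graphs are simple, so if a and b are adjacent no loop is created at c.
\<close>
definition contract :: "'a \<Rightarrow> 'a \<Rightarrow> 'a \<Rightarrow> 'a graph \<Rightarrow> 'a graph" where
  "contract a b c G =
     (insert c (verts G - {a, b}),
      {e \<in> edges G. a \<notin> e \<and> b \<notin> e} \<union>
      {{c, x} | x. x \<in> (neighborhood G a \<union> neighborhood G b) - {a, b}})"

inductive minor_step :: "'a graph \<Rightarrow> 'a graph \<Rightarrow> bool" where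
  delete_edge: "e \<in> edges G \<Longrightarrow> minor_step G (verts G, edges G - {e})"
| contract_nodes: "\<lbrakk> a \<in> verts G; b \<in> verts G; a \<noteq> b; c \<notin> verts G - {a, b} \<rbrakk>
    \<Longrightarrow> minor_step G (contract a b c G)"

text \<open>The names of the nodes are immaterial, so the last graph is taken up to isomorphism.\<close>
definition vertex_minor :: "'a graph \<Rightarrow> 'b graph \<Rightarrow> bool" where
  "vertex_minor H1 H2 \<longleftrightarrow> (\<exists>H. minor_step\<^sup>*\<^sup>* H2 H \<and> graph_iso H H1)"


section \<open>The problem Exact-Weight-H\<close>

definition exact_weight :: "'h graph \<Rightarrow> 'a graph \<Rightarrow> ('a set \<Rightarrow> int) \<Rightarrow> int \<Rightarrow> bool" where
  "exact_weight H G w t \<longleftrightarrow>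
     (\<exists>S. subgraph_of S G \<and> graph_iso S H \<and> (\<Sum>e\<in>edges S. w e) = t)"


section \<open>Word RAM\<close>

text \<open>
  A program uses finitely many registers and a random access memory, all holding signed words
  (addresses may be negative). Control flow is structured, which costs only a constant factor
  compared to jumps. Every instruction and every test costs one time unit. The parameter B bounds
  the absolute value of the words: an instruction whose result does not fit has no execution.
\<close>

datatype binop = Add | Sub | Mul | Div | Mod | And | Or | Xor | Shl | Shr

datatype instr =
    Const nat int
  | Op binop nat nat nat
  | Load nat nat
  | Store nat nat

datatype prog =
    Instr instr
  | Seq prog prog
  | IfPos nat prog prog
  | WhilePos nat prog

type_synonym state = "(nat \<Rightarrow> int) \<times> (int \<Rightarrow> int)"

fun binop_val :: "binop \<Rightarrow> int \<Rightarrow> int \<Rightarrow> int" where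
  "binop_val Add x y = x + y"
| "binop_val Sub x y = x - y"
| "binop_val Mul x y = x * y"
| "binop_val Div x y = x div y"
| "binop_val Mod x y = x mod y"
| "binop_val And x y = Bit_Operations.and x y"
| "binop_val Or x y = Bit_Operations.or x y"
| "binop_val Xor x y = Bit_Operations.xor x y"
| "binop_val Shl x y = push_bit (nat y) x"
| "binop_val Shr x y = drop_bit (nat y) x"

text \<open>
  In \<open>Op f r p q\<close>, the register r receives the result. \<open>Load r p\<close> reads the cell whose address is
  in register p into register r; \<open>Store p r\<close> writes register r to that cell.
\<close>
inductive exec_instr :: "int \<Rightarrow> instr \<Rightarrow> state \<Rightarrow> state \<Rightarrow> bool" for B :: int where
  "\<bar>c\<bar> \<le> B \<Longrightarrow> exec_instr B (Const r c) (\<rho>, m) (\<rho>(r := c), m)"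
| "\<lbrakk> v = binop_val f (\<rho> p) (\<rho> q); \<bar>v\<bar> \<le> B \<rbrakk>
    \<Longrightarrow> exec_instr B (Op f r p q) (\<rho>, m) (\<rho>(r := v), m)"
| "exec_instr B (Load r p) (\<rho>, m) (\<rho>(r := m (\<rho> p)), m)"
| "exec_instr B (Store p r) (\<rho>, m) (\<rho>, m(\<rho> p := \<rho> r))"

text \<open>\<open>exec B P s k s'\<close>: started in s, the program P halts in s' after k time units.\<close>
inductive exec :: "int \<Rightarrow> prog \<Rightarrow> state \<Rightarrow> nat \<Rightarrow> state \<Rightarrow> bool" for B :: int where
  Instr: "exec_instr B i s s' \<Longrightarrow> exec B (Instr i) s 1 s'"
| Seq: "\<lbrakk> exec B P s k s'; exec B Q s' l s'' \<rbrakk> \<Longrightarrow> exec B (Seq P Q) s (k + l) s''"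
| IfTrue: "\<lbrakk> fst s r > 0; exec B P s k s' \<rbrakk> \<Longrightarrow> exec B (IfPos r P Q) s (k + 1) s'"
| IfFalse: "\<lbrakk> fst s r \<le> 0; exec B Q s k s' \<rbrakk> \<Longrightarrow> exec B (IfPos r P Q) s (k + 1) s'"
| WhileFalse: "fst s r \<le> 0 \<Longrightarrow> exec B (WhilePos r P) s 1 s"
| WhileTrue: "\<lbrakk> fst s r > 0; exec B P s k s'; exec B (WhilePos r P) s' l s'' \<rbrakk>
    \<Longrightarrow> exec B (WhilePos r P) s (k + l + 1) s''"

lemma exec_instr_deterministic:
  "exec_instr B i s s' \<Longrightarrow> exec_instr B i s s'' \<Longrightarrow> s' = s''"
  by (auto elim!: exec_instr.cases)

inductive_cases exec_InstrE: "exec B (Instr i) s k s'"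
inductive_cases exec_SeqE: "exec B (Seq P Q) s k s'"
inductive_cases exec_IfPosE: "exec B (IfPos r P Q) s k s'"
inductive_cases exec_WhilePosE: "exec B (WhilePos r P) s k s'"

lemma exec_deterministic:
  "exec B P s k s' \<Longrightarrow> exec B P s l s'' \<Longrightarrow> k = l \<and> s' = s''"
proof (induction arbitrary: l s'' rule: exec.induct)
  case (Instr i s s')
  show ?case
    by (rule exec_InstrE[OF Instr.prems]) (use exec_instr_deterministic[OF Instr.hyps] in simp)
next
  case (Seq P s k s' Q l s'' l' t)
  show ?case by (rule exec_SeqE[OF Seq.prems]) (metis Seq.IH)
next
  case (IfTrue s r P k s' Q)
  show ?case
    by (rule exec_IfPosE[OF IfTrue.prems]) (simp, metis IfTrue.IH, use IfTrue.hyps(1) in simp)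
next
  case (IfFalse s r Q k s' P)
  show ?case
    by (rule exec_IfPosE[OF IfFalse.prems]) (use IfFalse.hyps(1) in simp, simp, metis IfFalse.IH)
next
  case (WhileFalse s r P)
  show ?case by (rule exec_WhilePosE[OF WhileFalse.prems]) (use WhileFalse.hyps in simp_all)
next
  case (WhileTrue s r P k s' l s'' l' t)
  show ?case
    by (rule exec_WhilePosE[OF WhileTrue.prems]) (use WhileTrue.hyps(1) in simp, metis WhileTrue.IH Suc_eq_plus1)
qed


section \<open>Solving Exact-Weight-H on the word RAM\<close>

text \<open>
  Input: a weighted graph on the nodes 0, ..., n - 1 as an adjacency matrix. Cell 2 (i n + j) tells
  whether i and j are adjacent and the next cell holds the weight of that edge; registers 0 and 1
  hold n and the target. Everything else is 0.
\<close>
definition input_mem :: "nat \<Rightarrow> nat set set \<Rightarrow> (nat set \<Rightarrow> int) \<Rightarrow> int \<Rightarrow> int" where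
  "input_mem n E w a =
     (let q = nat a div 2; e = {q div n, q mod n} in
      if a < 0 \<or> q \<ge> n * n \<or> e \<notin> E then 0 else if even a then 1 else w e)"

definition input_state :: "nat \<Rightarrow> nat set set \<Rightarrow> (nat set \<Rightarrow> int) \<Rightarrow> int \<Rightarrow> state" where
  "input_state n E w t = ((\<lambda>_. 0)(0 := int n, 1 := t), input_mem n E w)"

definition max_number :: "nat set set \<Rightarrow> (nat set \<Rightarrow> int) \<Rightarrow> int \<Rightarrow> int" where
  "max_number E w t = Max (insert \<bar>t\<bar> ((\<lambda>e. \<bar>w e\<bar>) ` E))"

text \<open>
  As usual for the word RAM, words have O(log (n + M)) bits, where M is the largest absolute value
  of an input number. The weights are arbitrary integers and the time bound depends on n only.
\<close>
definition solves_exact_weight :: "'h graph \<Rightarrow> prog \<Rightarrow> nat \<Rightarrow> (nat \<Rightarrow> nat) \<Rightarrow> bool" where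
  "solves_exact_weight H P d T \<longleftrightarrow>
     (\<forall>n E w t. simple_graph ({..<n}, E) \<longrightarrow>
        (\<exists>k s. exec ((int n + max_number E w t + 2) ^ d) P (input_state n E w t) k s \<and>
               k \<le> T n \<and> (fst s 0 > 0 \<longleftrightarrow> exact_weight H ({..<n}, E) w t)))"

definition exact_weight_solvable_in :: "'h graph \<Rightarrow> (nat \<Rightarrow> real) set \<Rightarrow> bool" where
  "exact_weight_solvable_in H F \<longleftrightarrow>
     (\<exists>P d T. solves_exact_weight H P d T \<and> (\<lambda>n. real (T n)) \<in> F)"

definition soft_O :: "(nat \<Rightarrow> real) \<Rightarrow> (nat \<Rightarrow> real) set" where
  "soft_O g = {f. \<exists>c::nat. f \<in> O(\<lambda>n. g n * ln (real n) ^ c)}"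

end

theory Submission imports Defs "HOL-Library.Log_Nat" begin

text \<open>
  A vertex-minor H1 of H2 comes with a surjection \<open>\<phi>\<close> of the nodes of H2 onto those of H1 such that
  every edge of H1 is the image of an edge of H2. Given a weighted graph G on n nodes, take a copy
  (u, x) of each node x of G for each node u of H2, and join (u, x) to (v, y) only if uv is an edge
  of H2, where one designated edge of H2 over each edge of H1 carries the edges and weights of G.
  The weights are extended by low-order digits which force a copy of H2 of the right total weight
  to use exactly one edge over each edge of H2, and to choose the same x over all nodes of H2 with
  the same image under \<open>\<phi>\<close>. Distinct nodes of H1 get distinct x by colour coding: for every pair
  i < j of nodes of H1, a bit position is guessed at which the two choices differ, which gives
  polylogarithmically many instances.

  The given program is simulated on each instance with its memory stored in the negative addresses.
  Cells carry the number of the instance as a time stamp, so the memory need not be cleared, and a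
  cell without a current stamp stands for the input of the instance, which is computed on demand.
\<close>

text \<open>An edge of H2 may lie over a deleted edge, inside a contracted set, or over the same
  edge of H1 as another one. It must still occur in every copy, so unless it is designated its class
  joins all pairs of admissible colours and carries no original weight. A copy of H2 in the new
  graph need not respect the layers: an edge of H2 may land over a different edge of H2. The extra
  digits therefore speak about classes of edges: m digits count each class once and 2 m digits
  compare the ends of each class with references. Their sums do not depend on which edge of H2
  landed in which class. The given weight is the top digit because it alone has no bound in n. Nodes
  of H1 over which H2 has only isolated nodes are placed last, which needs k \<le> n. Word size is
  the second obstacle. The given program gets words polynomial in its own input numbers, so these
  must be polynomial in those of G with an exponent fixed in advance. Graph size, target and new
  weights are values of fixed expressions, and one syntactic bound on expressions covers them
  all.\<close>

section \<open>Programs and expressions\<close>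

text \<open>Registers from T on are scratch registers: their contents are irrelevant before and after.\<close>
definition runs :: "nat \<Rightarrow> int \<Rightarrow> prog \<Rightarrow> state \<Rightarrow> nat \<Rightarrow> state \<Rightarrow> bool" where
  "runs T B P s c s' \<longleftrightarrow>
     (\<forall>\<rho>. (\<forall>r<T. \<rho> r = fst s r) \<longrightarrow>
        (\<exists>\<rho>' k. exec B P (\<rho>, snd s) k (\<rho>', snd s') \<and> k \<le> c \<and> (\<forall>r<T. \<rho>' r = fst s' r)))"

lemma runs_mono: "runs T B P s c s' \<Longrightarrow> c \<le> c' \<Longrightarrow> runs T B P s c' s'"
  unfolding runs_def by (meson le_trans)

lemma runs_Seq:
  assumes "runs T B P s c s'" "runs T B Q s' c' s''"
  shows "runs T B (Seq P Q) s (c + c') s''"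
  unfolding runs_def
proof (intro allI impI)
  fix \<rho> assume "\<forall>r<T. \<rho> r = fst s r"
  then obtain \<rho>1 k where 1: "exec B P (\<rho>, snd s) k (\<rho>1, snd s')" "k \<le> c" "\<forall>r<T. \<rho>1 r = fst s' r"
    using assms(1) unfolding runs_def by blast
  then obtain \<rho>2 l where "exec B Q (\<rho>1, snd s') l (\<rho>2, snd s'')" "l \<le> c'" "\<forall>r<T. \<rho>2 r = fst s'' r"
    using assms(2) unfolding runs_def by blast
  with 1 show "\<exists>\<rho>' k. exec B (Seq P Q) (\<rho>, snd s) k (\<rho>', snd s'') \<and> k \<le> c + c' \<and>
      (\<forall>r<T. \<rho>' r = fst s'' r)"
    by (meson exec.Seq add_mono)
qed

lemma runs_IfPos:
  assumes "r < T" "runs T B (if fst s r > 0 then P else Q) s c s'"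
  shows "runs T B (IfPos r P Q) s (c + 1) s'"
  unfolding runs_def
proof (intro allI impI)
  fix \<rho> assume \<rho>: "\<forall>r<T. \<rho> r = fst s r"
  then obtain \<rho>1 k where 1: "exec B (if fst s r > 0 then P else Q) (\<rho>, snd s) k (\<rho>1, snd s')"
      "k \<le> c" "\<forall>r<T. \<rho>1 r = fst s' r"
    using assms(2) unfolding runs_def by blast
  have "exec B (IfPos r P Q) (\<rho>, snd s) (k + 1) (\<rho>1, snd s')"
  proof (cases "fst s r > 0")
    case True
    then show ?thesis using 1(1) \<rho> assms(1) by (intro exec.IfTrue) auto
  next
    case False
    then show ?thesis using 1(1) \<rho> assms(1) by (intro exec.IfFalse) auto
  qed
  with 1 show "\<exists>\<rho>' k. exec B (IfPos r P Q) (\<rho>, snd s) k (\<rho>', snd s') \<and> k \<le> c + 1 \<and>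
      (\<forall>r<T. \<rho>' r = fst s' r)"
    by (metis add_le_mono1)
qed

lemma runs_WhileFalse:
  assumes "r < T" "fst s r \<le> 0"
  shows "runs T B (WhilePos r P) s 1 s"
  unfolding runs_def
proof (intro allI impI)
  fix \<rho> assume \<rho>: "\<forall>r<T. \<rho> r = fst s r"
  then have "exec B (WhilePos r P) (\<rho>, snd s) 1 (\<rho>, snd s)"
    using assms by (intro exec.WhileFalse) auto
  with \<rho> show "\<exists>\<rho>' k. exec B (WhilePos r P) (\<rho>, snd s) k (\<rho>', snd s) \<and> k \<le> 1 \<and>
      (\<forall>r<T. \<rho>' r = fst s r)"
    by blast
qed

lemma runs_WhileTrue:
  assumes "r < T" "fst s r > 0" "runs T B P s c s'" "runs T B (WhilePos r P) s' c' s''"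
  shows "runs T B (WhilePos r P) s (c + c' + 1) s''"
  unfolding runs_def
proof (intro allI impI)
  fix \<rho> assume \<rho>: "\<forall>r<T. \<rho> r = fst s r"
  then obtain \<rho>1 k where 1: "exec B P (\<rho>, snd s) k (\<rho>1, snd s')" "k \<le> c" "\<forall>r<T. \<rho>1 r = fst s' r"
    using assms(3) unfolding runs_def by blast
  then obtain \<rho>2 l where 2: "exec B (WhilePos r P) (\<rho>1, snd s') l (\<rho>2, snd s'')" "l \<le> c'"
      "\<forall>r<T. \<rho>2 r = fst s'' r"
    using assms(4) unfolding runs_def by blast
  have "exec B (WhilePos r P) (\<rho>, snd s) (k + l + 1) (\<rho>2, snd s'')"
    using 1 2 \<rho> assms by (intro exec.WhileTrue) auto
  with 1 2 show "\<exists>\<rho>' k. exec B (WhilePos r P) (\<rho>, snd s) k (\<rho>', snd s'') \<and> k \<le> c + c' + 1 \<and>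
      (\<forall>r<T. \<rho>' r = fst s'' r)"
    by (intro exI[of _ \<rho>2] exI[of _ "k + l + 1"]) auto
qed

section \<open>Constant-size arithmetic expressions and their compilation\<close>

datatype expr =
    Num int
  | Var nat
  | Bin binop expr expr
  | Cell expr
  | Ite expr expr expr

primrec eval :: "state \<Rightarrow> expr \<Rightarrow> int" where
  "eval s (Num c) = c"
| "eval s (Var v) = fst s v"
| "eval s (Bin f a b) = binop_val f (eval s a) (eval s b)"
| "eval s (Cell a) = snd s (eval s a)"
| "eval s (Ite c a b) = (if eval s c > 0 then eval s a else eval s b)"

text \<open>Both branches of \<open>Ite\<close> have to fit although only one is executed: the later
  bound is syntactic and covers both.\<close>

primrec fits :: "int \<Rightarrow> state \<Rightarrow> expr \<Rightarrow> bool" where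
  "fits B s (Num c) \<longleftrightarrow> \<bar>c\<bar> \<le> B"
| "fits B s (Var v) \<longleftrightarrow> \<bar>fst s v\<bar> \<le> B"
| "fits B s (Bin f a b) \<longleftrightarrow> fits B s a \<and> fits B s b \<and> \<bar>binop_val f (eval s a) (eval s b)\<bar> \<le> B"
| "fits B s (Cell a) \<longleftrightarrow> fits B s a \<and> \<bar>snd s (eval s a)\<bar> \<le> B"
| "fits B s (Ite c a b) \<longleftrightarrow> fits B s c \<and> fits B s a \<and> fits B s b"

primrec wf_expr :: "nat \<Rightarrow> expr \<Rightarrow> bool" where
  "wf_expr T (Num c) \<longleftrightarrow> True"
| "wf_expr T (Var v) \<longleftrightarrow> v < T"
| "wf_expr T (Bin f a b) \<longleftrightarrow> f \<in> {Add, Sub, Mul, Div, Mod, Shr} \<and> wf_expr T a \<and> wf_expr T b"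
| "wf_expr T (Cell a) \<longleftrightarrow> wf_expr T a"
| "wf_expr T (Ite c a b) \<longleftrightarrow> wf_expr T c \<and> wf_expr T a \<and> wf_expr T b"

primrec cost :: "expr \<Rightarrow> nat" where
  "cost (Num c) = 1"
| "cost (Var v) = 1"
| "cost (Bin f a b) = cost a + cost b + 1"
| "cost (Cell a) = cost a + 1"
| "cost (Ite c a b) = cost c + cost a + cost b + 1"

text \<open>Registers are used as a stack: the value ends in r, everything above r is scratch,
  everything below survives. \<open>Or\<close> of a register with itself serves as a copy.\<close>

primrec compile :: "nat \<Rightarrow> expr \<Rightarrow> prog" where
  "compile r (Num c) = Instr (Const r c)"
| "compile r (Var v) = Instr (Op Or r v v)"
| "compile r (Bin f a b) = Seq (compile r a) (Seq (compile (r + 1) b) (Instr (Op f r r (r + 1))))"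
| "compile r (Cell a) = Seq (compile r a) (Instr (Load r r))"
| "compile r (Ite c a b) = Seq (compile r c) (IfPos r (compile r a) (compile r b))"

lemma eval_cong:
  "wf_expr T e \<Longrightarrow> \<forall>r<T. fst s r = fst s' r \<Longrightarrow> snd s = snd s' \<Longrightarrow> eval s e = eval s' e"
  by (induction e) auto

lemma fits_cong:
  "wf_expr T e \<Longrightarrow> \<forall>r<T. fst s r = fst s' r \<Longrightarrow> snd s = snd s' \<Longrightarrow> fits B s e = fits B s' e"
proof (induction e)
  case (Bin f a b)
  then show ?case using eval_cong[of T a s s'] eval_cong[of T b s s'] by simp
next
  case (Cell a)
  then show ?case using eval_cong[of T a s s'] by simp
qed auto

lemma wf_expr_mono: "wf_expr T e \<Longrightarrow> T \<le> T' \<Longrightarrow> wf_expr T' e"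
  by (induction e) auto

lemma fits_eval: "fits B s e \<Longrightarrow> \<bar>eval s e\<bar> \<le> B"
  by (induction e) auto

lemma exec_Op: "\<bar>binop_val f (\<rho> p) (\<rho> q)\<bar> \<le> B \<Longrightarrow>
    exec B (Instr (Op f r p q)) (\<rho>, m) 1 (\<rho>(r := binop_val f (\<rho> p) (\<rho> q)), m)"
  by (intro exec.Instr exec_instr.intros) auto

text \<open>Variables lie below the target register, so evaluating one subexpression cannot change
  the value of the next; \<open>eval_cong\<close> and \<open>fits_cong\<close> transport
  this.\<close>

lemma exec_compile:
  assumes "wf_expr r e" "fits B (\<rho>, m) e"
  shows "\<exists>\<rho>' k. exec B (compile r e) (\<rho>, m) k (\<rho>', m) \<and> k \<le> cost e \<and>
     \<rho>' r = eval (\<rho>, m) e \<and> (\<forall>q<r. \<rho>' q = \<rho> q)"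
  using assms
proof (induction e arbitrary: r \<rho>)
  case (Num c)
  then have "exec B (compile r (Num c)) (\<rho>, m) 1 (\<rho>(r := c), m)"
    unfolding compile.simps by (intro exec.Instr exec_instr.intros) simp
  moreover have "(\<rho>(r := c)) r = eval (\<rho>, m) (Num c)" "\<forall>q<r. (\<rho>(r := c)) q = \<rho> q" by auto
  ultimately show ?case by (metis cost.simps(1) order_refl)
next
  case (Var v)
  then have "exec B (compile r (Var v)) (\<rho>, m) 1 (\<rho>(r := \<rho> v), m)"
    using exec_Op[of Or \<rho> v v B r m] by simp
  moreover have "(\<rho>(r := \<rho> v)) r = eval (\<rho>, m) (Var v)" "\<forall>q<r. (\<rho>(r := \<rho> v)) q = \<rho> q"
    by auto
  ultimately show ?case by (metis cost.simps(2) order_refl)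
next
  case (Bin f a b)
  obtain \<rho>1 k1 where 1: "exec B (compile r a) (\<rho>, m) k1 (\<rho>1, m)" "k1 \<le> cost a"
      "\<rho>1 r = eval (\<rho>, m) a" "\<forall>q<r. \<rho>1 q = \<rho> q"
    using Bin.IH(1)[of r \<rho>] Bin.prems by auto
  have eq: "eval (\<rho>1, m) b = eval (\<rho>, m) b" and fit: "fits B (\<rho>1, m) b"
    using Bin.prems 1(4) eval_cong[of r b "(\<rho>1, m)" "(\<rho>, m)"]
      fits_cong[of r b "(\<rho>1, m)" "(\<rho>, m)"] by auto
  obtain \<rho>2 k2 where 2: "exec B (compile (r + 1) b) (\<rho>1, m) k2 (\<rho>2, m)" "k2 \<le> cost b"
      "\<rho>2 (r + 1) = eval (\<rho>, m) b" "\<forall>q<r + 1. \<rho>2 q = \<rho>1 q"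
    using Bin.IH(2)[of "r + 1" \<rho>1] Bin.prems fit eq wf_expr_mono[of r b "r + 1"] by auto
  define \<rho>3 where "\<rho>3 = \<rho>2(r := eval (\<rho>, m) (Bin f a b))"
  have "exec B (Instr (Op f r r (r + 1))) (\<rho>2, m) 1 (\<rho>3, m)"
    using exec_Op[of f \<rho>2 r "r + 1" B r m] 1 2 Bin.prems by (simp add: \<rho>3_def)
  from exec.Seq[OF 1(1) exec.Seq[OF 2(1) this]]
  have "exec B (compile r (Bin f a b)) (\<rho>, m) (k1 + (k2 + 1)) (\<rho>3, m)" by simp
  moreover have "\<rho>3 r = eval (\<rho>, m) (Bin f a b)" "\<forall>q<r. \<rho>3 q = \<rho> q"
    using 1(4) 2(4) by (simp_all add: \<rho>3_def)
  moreover have "k1 + (k2 + 1) \<le> cost (Bin f a b)" using 1(2) 2(2) by simp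
  ultimately show ?case by blast
next
  case (Cell a)
  obtain \<rho>1 k1 where 1: "exec B (compile r a) (\<rho>, m) k1 (\<rho>1, m)" "k1 \<le> cost a"
      "\<rho>1 r = eval (\<rho>, m) a" "\<forall>q<r. \<rho>1 q = \<rho> q"
    using Cell.IH(1)[of r \<rho>] Cell.prems by auto
  define \<rho>2 where "\<rho>2 = \<rho>1(r := m (\<rho>1 r))"
  have "exec B (Instr (Load r r)) (\<rho>1, m) 1 (\<rho>2, m)"
    unfolding \<rho>2_def by (intro exec.Instr exec_instr.intros)
  from exec.Seq[OF 1(1) this]
  have "exec B (compile r (Cell a)) (\<rho>, m) (k1 + 1) (\<rho>2, m)" by simp
  moreover have "\<rho>2 r = eval (\<rho>, m) (Cell a)" "\<forall>q<r. \<rho>2 q = \<rho> q"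
    using 1(3,4) by (simp_all add: \<rho>2_def)
  moreover have "k1 + 1 \<le> cost (Cell a)" using 1(2) by simp
  ultimately show ?case by blast
next
  case (Ite c a b)
  obtain \<rho>1 k1 where 1: "exec B (compile r c) (\<rho>, m) k1 (\<rho>1, m)" "k1 \<le> cost c"
      "\<rho>1 r = eval (\<rho>, m) c" "\<forall>q<r. \<rho>1 q = \<rho> q"
    using Ite.IH(1)[of r \<rho>] Ite.prems by auto
  let ?d = "if eval (\<rho>, m) c > 0 then a else b"
  have "wf_expr r ?d" and "fits B (\<rho>, m) ?d" using Ite.prems by auto
  then have eq: "eval (\<rho>1, m) ?d = eval (\<rho>, m) ?d" and fit: "fits B (\<rho>1, m) ?d"
    using 1(4) eval_cong[of r ?d "(\<rho>1, m)" "(\<rho>, m)"] fits_cong[of r ?d "(\<rho>1, m)" "(\<rho>, m)"] by auto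
  obtain \<rho>2 k2 where 2: "exec B (compile r ?d) (\<rho>1, m) k2 (\<rho>2, m)" "k2 \<le> cost a + cost b"
      "\<rho>2 r = eval (\<rho>1, m) ?d" "\<forall>q<r. \<rho>2 q = \<rho>1 q"
    using Ite.IH(2)[of r \<rho>1] Ite.IH(3)[of r \<rho>1] Ite.prems fit
    by (cases "eval (\<rho>, m) c > 0") (simp_all, (meson trans_le_add1 trans_le_add2)+)
  have "exec B (IfPos r (compile r a) (compile r b)) (\<rho>1, m) (k2 + 1) (\<rho>2, m)"
  proof (cases "eval (\<rho>, m) c > 0")
    case True
    then show ?thesis using 2(1) 1(3) by (intro exec.IfTrue) auto
  next
    case False
    then show ?thesis using 2(1) 1(3) by (intro exec.IfFalse) auto
  qed
  from exec.Seq[OF 1(1) this]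
  show ?case using 1 2 eq by (intro exI[of _ \<rho>2] exI[of _ "k1 + (k2 + 1)"]) auto
qed

text \<open>The value is built in the scratch area first, because compiling at r would destroy the
  registers above r, which e may read.\<close>

definition assign :: "nat \<Rightarrow> nat \<Rightarrow> expr \<Rightarrow> prog" where
  "assign T r e = Seq (compile T e) (Instr (Op Or r T T))"

lemma runs_assign:
  assumes "wf_expr T e" "fits B s e" "r < T"
  shows "runs T B (assign T r e) s (cost e + 1) ((fst s)(r := eval s e), snd s)"
  unfolding runs_def
proof (intro allI impI)
  fix \<rho> assume \<rho>: "\<forall>r<T. \<rho> r = fst s r"
  have eq: "eval (\<rho>, snd s) e = eval s e" and fit: "fits B (\<rho>, snd s) e"
    using \<rho> assms eval_cong[of T e "(\<rho>, snd s)" s] fits_cong[of T e "(\<rho>, snd s)" s] by auto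
  obtain \<rho>1 k where 1: "exec B (compile T e) (\<rho>, snd s) k (\<rho>1, snd s)" "k \<le> cost e"
      "\<rho>1 T = eval s e" "\<forall>q<T. \<rho>1 q = \<rho> q"
    using exec_compile[OF assms(1) fit] eq by auto
  define \<rho>2 where "\<rho>2 = \<rho>1(r := eval s e)"
  have "exec B (Instr (Op Or r T T)) (\<rho>1, snd s) 1 (\<rho>2, snd s)"
    using exec_Op[of Or \<rho>1 T T B r "snd s"] 1(3) fits_eval[OF assms(2)] by (simp add: \<rho>2_def)
  moreover have "\<forall>q<T. \<rho>2 q = ((fst s)(r := eval s e)) q" using 1(4) \<rho> by (simp add: \<rho>2_def)
  ultimately show "\<exists>\<rho>' k. exec B (assign T r e) (\<rho>, snd s) k
        (\<rho>', snd ((fst s)(r := eval s e), snd s)) \<and> k \<le> cost e + 1 \<and>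
      (\<forall>q<T. \<rho>' q = fst ((fst s)(r := eval s e), snd s) q)"
    using exec.Seq[OF 1(1)] 1(2) unfolding assign_def fst_conv snd_conv by (meson add_le_mono1)
qed

definition store :: "nat \<Rightarrow> expr \<Rightarrow> nat \<Rightarrow> prog" where
  "store T e r = Seq (compile T e) (Instr (Store T r))"

lemma runs_store:
  assumes "wf_expr T e" "fits B s e" "r < T"
  shows "runs T B (store T e r) s (cost e + 1) (fst s, (snd s)(eval s e := fst s r))"
  unfolding runs_def
proof (intro allI impI)
  fix \<rho> assume \<rho>: "\<forall>r<T. \<rho> r = fst s r"
  have eq: "eval (\<rho>, snd s) e = eval s e" and fit: "fits B (\<rho>, snd s) e"
    using \<rho> assms eval_cong[of T e "(\<rho>, snd s)" s] fits_cong[of T e "(\<rho>, snd s)" s] by auto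
  obtain \<rho>1 k where 1: "exec B (compile T e) (\<rho>, snd s) k (\<rho>1, snd s)" "k \<le> cost e"
      "\<rho>1 T = eval s e" "\<forall>q<T. \<rho>1 q = \<rho> q"
    using exec_compile[OF assms(1) fit] eq by auto
  have "exec B (Instr (Store T r)) (\<rho>1, snd s) 1 (\<rho>1, (snd s)(\<rho>1 T := \<rho>1 r))"
    by (intro exec.Instr exec_instr.intros)
  from exec.Seq[OF 1(1) this] 1 \<rho> assms(3)
  show "\<exists>\<rho>' k. exec B (store T e r) (\<rho>, snd s) k
        (\<rho>', snd (fst s, (snd s)(eval s e := fst s r))) \<and> k \<le> cost e + 1 \<and>
      (\<forall>q<T. \<rho>' q = fst (fst s, (snd s)(eval s e := fst s r)) q)"
    unfolding store_def by (intro exI[of _ \<rho>1] exI[of _ "k + 1"]) auto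
qed

section \<open>Polynomial bounds on intermediate values\<close>

text \<open>
  If all registers and cells are bounded by \<open>X ^ a\<close> with \<open>X \<ge> 2\<close>, then all intermediate values are
  bounded by \<open>X ^ ebound a e\<close>. With X = n + M + 2 this yields words of O(log (n + M)) bits.
\<close>
primrec ebound :: "nat \<Rightarrow> expr \<Rightarrow> nat" where
  "ebound a (Num c) = nat \<bar>c\<bar>"
| "ebound a (Var v) = a"
| "ebound a (Bin f e1 e2) = ebound a e1 + ebound a e2 + 1"
| "ebound a (Cell e) = ebound a e + a"
| "ebound a (Ite c e1 e2) = ebound a c + ebound a e1 + ebound a e2"

lemma nat_le_power: fixes X :: int assumes "X \<ge> 2" shows "int c \<le> X ^ c"
proof -
  have "int c < 2 ^ c" by (metis of_nat_less_two_power)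
  also have "(2::int) ^ c \<le> X ^ c" using assms by (intro power_mono) auto
  finally show ?thesis by simp
qed

lemma abs_div_le: "\<bar>x div b\<bar> \<le> \<bar>x :: int\<bar>"
proof -
  have pos: "\<bar>x div b\<bar> \<le> \<bar>x\<bar>" if "b > 0" for x b :: int
  proof (cases "x \<ge> 0")
    case True
    then have "x div b \<le> x div 1" "0 \<le> x div b"
      using that by (intro zdiv_mono2, auto simp: pos_imp_zdiv_nonneg_iff)
    then show ?thesis using True by simp
  next
    case False
    \<comment> \<open>Division rounds towards minus infinity, so for negative x the quotient has to
      be bounded from below; the remainder being less than b does it.\<close>
    have "x \<le> x div b"
    proof (rule ccontr)
      assume "\<not> x \<le> x div b"
      then have "b * (x div b) \<le> b * (x - 1)" using that by (intro mult_left_mono) auto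
      moreover have "x < b * (x div b) + b" using that mult_div_mod_eq[of b x]
        pos_mod_bound[of b x] by linarith
      ultimately have "x < b * x" by (simp add: algebra_simps)
      moreover have "b * x \<le> 1 * x" using that False by (intro mult_right_mono_neg) auto
      ultimately show False by simp
    qed
    moreover have "x div b < 0" using False that by (simp add: pos_imp_zdiv_neg_iff)
    ultimately show ?thesis using False by simp
  qed
  consider "b > 0" | "b = 0" | "b < 0" by linarith
  then show ?thesis
  proof cases
    case 3
    then show ?thesis using pos[of "- b" "- x"] by simp
  qed (use pos in auto)
qed

text \<open>Everything reduces to |x| + |y| or |x y|. A right shift is a division by a power of two
  and shrinks x whatever the shift amount is.\<close>

lemma binop_bound:
  assumes "f \<in> {Add, Sub, Mul, Div, Mod, Shr}" "\<bar>x\<bar> \<le> U" "\<bar>y\<bar> \<le> V" "U \<ge> 1" "V \<ge> 1"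
  shows "\<bar>binop_val f x y\<bar> \<le> 2 * U * V"
proof -
  have UV: "U \<le> U * V" "V \<le> U * V" using assms(4,5) by auto
  have xy: "\<bar>x * y\<bar> \<le> U * V" unfolding abs_mult using assms by (intro mult_mono) auto
  have dv: "\<bar>x div b\<bar> \<le> \<bar>x\<bar>" for b by (rule abs_div_le)
  have md: "\<bar>x mod y\<bar> \<le> \<bar>x\<bar> + \<bar>y\<bar>"
  proof (cases "y = 0")
    case False
    then show ?thesis using abs_mod_less[of y x] by linarith
  qed simp
  have "\<bar>binop_val f x y\<bar> \<le> \<bar>x\<bar> + \<bar>y\<bar> \<or> \<bar>binop_val f x y\<bar> \<le> \<bar>x * y\<bar>"
    using assms(1) md dv[of y] dv[of "2 ^ nat y"]
    by (elim insertE emptyE) (simp_all add: drop_bit_eq_div, linarith+)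
  then show ?thesis using UV xy assms(2,3) by linarith
qed

lemma fits_poly:
  assumes "X \<ge> 2" "wf_expr T e" "\<forall>r<T. \<bar>fst s r\<bar> \<le> X ^ a" "\<forall>c. \<bar>snd s c\<bar> \<le> X ^ a"
    "ebound a e \<le> b"
  shows "fits (X ^ b) s e \<and> \<bar>eval s e\<bar> \<le> X ^ ebound a e"
proof -
  have mono: "X ^ i \<le> X ^ j" if "i \<le> j" for i j using that assms(1) by (intro power_increasing) auto
  have mono': "x \<le> X ^ j" if "x \<le> X ^ i" "i \<le> j" for x i j
    using that mono[of i j] by simp
  show ?thesis using assms(2,5)
  proof (induction e arbitrary: b)
    case (Num c)
    have "\<bar>c\<bar> \<le> X ^ nat \<bar>c\<bar>" using nat_le_power[OF assms(1), of "nat \<bar>c\<bar>"] by simp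
    then show ?case using Num mono'[of "\<bar>c\<bar>"] by auto
  next
    case (Var v)
    then show ?case using assms(3) mono'[of "\<bar>fst s v\<bar>"] by auto
  next
    case (Bin f e1 e2)
    have 1: "fits (X ^ b) s e1" "\<bar>eval s e1\<bar> \<le> X ^ ebound a e1" using Bin.IH(1)[of b] Bin.prems by auto
    have 2: "fits (X ^ b) s e2" "\<bar>eval s e2\<bar> \<le> X ^ ebound a e2" using Bin.IH(2)[of b] Bin.prems by auto
    have "\<bar>eval s (Bin f e1 e2)\<bar> \<le> 2 * X ^ ebound a e1 * X ^ ebound a e2"
      using binop_bound[of f, OF _ 1(2) 2(2)] Bin.prems(1) assms(1) by simp
    \<comment> \<open>The factor 2 of \<open>binop_bound\<close> costs one more power of X, which is
      the \<open>+ 1\<close> in \<open>ebound\<close>.\<close>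
    also have "\<dots> \<le> X * X ^ ebound a e1 * X ^ ebound a e2"
      using assms(1) by (intro mult_right_mono) auto
    also have "\<dots> = X ^ ebound a (Bin f e1 e2)" by (simp add: power_add)
    finally have 3: "\<bar>eval s (Bin f e1 e2)\<bar> \<le> X ^ ebound a (Bin f e1 e2)" .
    then show ?case using 1 2 mono'[OF 3 Bin.prems(2)] by simp
  next
    case (Cell e)
    then show ?case using assms(4) mono'[of "\<bar>snd s (eval s e)\<bar>" a] by auto
  next
    case (Ite c e1 e2)
    then show ?case using mono'[of "\<bar>eval s e1\<bar>" "ebound a e1" "ebound a (Ite c e1 e2)"]
       mono'[of "\<bar>eval s e2\<bar>" "ebound a e2" "ebound a (Ite c e1 e2)"] by auto
  qed
qed

section \<open>Simulation with stamped memory\<close>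

text \<open>
  The simulated cell a lives at the negative address \<open>loc a\<close> and its time stamp at \<open>loc a - 1\<close>.
\<close>
definition loc :: "int \<Rightarrow> int" where
  "loc a = (if a < 0 then 4 * a + 1 else - 4 * a - 1)"

lemma loc_neg: "loc a < 0" "loc a - 1 < 0"
  by (auto simp: loc_def)

text \<open>Modulo 4, \<open>loc a\<close> is 3 for a \<ge> 0 and 1 for a < 0, and the stamps have
  residues 2 and 0. So values and stamps never collide, and the nonnegative addresses stay free for
  the original input.\<close>

lemma loc_eq_iff: "loc a = loc b \<longleftrightarrow> a = b"
  unfolding loc_def by (cases "a < 0"; cases "b < 0"; simp; presburger)

lemma loc_neq_tag: "loc a \<noteq> loc b - 1"
  unfolding loc_def by (cases "a < 0"; cases "b < 0"; simp; presburger)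

definition loc_e :: "nat \<Rightarrow> expr" where
  "loc_e A = Ite (Bin Sub (Num 0) (Var A)) (Bin Add (Bin Mul (Num 4) (Var A)) (Num 1))
     (Bin Sub (Bin Mul (Num (- 4)) (Var A)) (Num 1))"

definition tag_e :: "nat \<Rightarrow> expr" where
  "tag_e A = Bin Sub (loc_e A) (Num 1)"

definition eq_e :: "expr \<Rightarrow> expr \<Rightarrow> expr" where
  "eq_e x y = Ite (Bin Sub x y) (Num 0) (Ite (Bin Sub y x) (Num 0) (Num 1))"

definition load_e :: "nat \<Rightarrow> nat \<Rightarrow> expr \<Rightarrow> expr" where
  "load_e A Z v = Ite (eq_e (Cell (tag_e A)) (Var Z)) (Cell (loc_e A)) v"

lemma eval_loc_e [simp]: "eval s (loc_e A) = loc (fst s A)"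
  by (simp add: loc_e_def loc_def)

lemma eval_tag_e [simp]: "eval s (tag_e A) = loc (fst s A) - 1"
  by (simp add: tag_e_def)

lemma eval_eq_e [simp]: "eval s (eq_e x y) = of_bool (eval s x = eval s y)"
  by (simp add: eq_e_def)

lemma wf_eq_e [simp]: "wf_expr T (eq_e x y) \<longleftrightarrow> wf_expr T x \<and> wf_expr T y"
  by (auto simp: eq_e_def)

lemma wf_loc_e [simp]: "wf_expr T (loc_e A) \<longleftrightarrow> A < T"
  by (simp add: loc_e_def)

lemma wf_tag_e [simp]: "wf_expr T (tag_e A) \<longleftrightarrow> A < T"
  by (simp add: tag_e_def)

primrec instr_below :: "nat \<Rightarrow> instr \<Rightarrow> bool" where
  "instr_below R (Const r c) \<longleftrightarrow> r < R"
| "instr_below R (Op f r p q) \<longleftrightarrow> r < R \<and> p < R \<and> q < R"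
| "instr_below R (Load r p) \<longleftrightarrow> r < R \<and> p < R"
| "instr_below R (Store p r) \<longleftrightarrow> r < R \<and> p < R"

primrec prog_below :: "nat \<Rightarrow> prog \<Rightarrow> bool" where
  "prog_below R (Instr i) \<longleftrightarrow> instr_below R i"
| "prog_below R (Seq P Q) \<longleftrightarrow> prog_below R P \<and> prog_below R Q"
| "prog_below R (IfPos r P Q) \<longleftrightarrow> r < R \<and> prog_below R P \<and> prog_below R Q"
| "prog_below R (WhilePos r P) \<longleftrightarrow> r < R \<and> prog_below R P"

lemma prog_below_mono: "prog_below R P \<Longrightarrow> R \<le> R' \<Longrightarrow> prog_below R' P"
proof (induction P)
  case (Instr i)
  then show ?case by (cases i) auto
qed auto

lemma ex_prog_below: "\<exists>R. prog_below R P"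
proof (induction P)
  case (Instr i)
  show ?case
  proof (cases i)
    case (Const r c)
    then show ?thesis by (intro exI[of _ "Suc r"]) simp
  next
    case (Op f r p q)
    then show ?thesis by (intro exI[of _ "Suc (r + p + q)"]) simp
  next
    case (Load r p)
    then show ?thesis by (intro exI[of _ "Suc (r + p)"]) simp
  next
    case (Store p r)
    then show ?thesis by (intro exI[of _ "Suc (r + p)"]) simp
  qed
next
  case (Seq P Q)
  then obtain R R' where "prog_below R P" "prog_below R' Q" by blast
  then show ?case
    using prog_below_mono[of R P "R + R'"] prog_below_mono[of R' Q "R + R'"] by auto
next
  case (IfPos r P Q)
  then obtain R R' where "prog_below R P" "prog_below R' Q" by blast
  then show ?case
    using prog_below_mono[of R P "R + R' + Suc r"] prog_below_mono[of R' Q "R + R' + Suc r"]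
    by (intro exI[of _ "R + R' + Suc r"]) auto
next
  case (WhilePos r P)
  then obtain R where "prog_below R P" by blast
  then show ?case
    using prog_below_mono[of R P "R + Suc r"] by (intro exI[of _ "R + Suc r"]) auto
qed

text \<open>The address goes to the fixed register A first, since v is one fixed expression and
  reads it there. The simulated registers are the real ones, so only memory accesses change.\<close>

primrec sim_instr :: "nat \<Rightarrow> nat \<Rightarrow> nat \<Rightarrow> expr \<Rightarrow> instr \<Rightarrow> prog" where
  "sim_instr T A Z v (Const r c) = Instr (Const r c)"
| "sim_instr T A Z v (Op f r p q) = Instr (Op f r p q)"
| "sim_instr T A Z v (Load r p) = Seq (assign T A (Var p)) (assign T r (load_e A Z v))"
| "sim_instr T A Z v (Store p r) =
     Seq (assign T A (Var p)) (Seq (store T (loc_e A) r) (store T (tag_e A) Z))"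

primrec sim :: "nat \<Rightarrow> nat \<Rightarrow> nat \<Rightarrow> expr \<Rightarrow> prog \<Rightarrow> prog" where
  "sim T A Z v (Instr i) = sim_instr T A Z v i"
| "sim T A Z v (Seq P Q) = Seq (sim T A Z v P) (sim T A Z v Q)"
| "sim T A Z v (IfPos r P Q) = IfPos r (sim T A Z v P) (sim T A Z v Q)"
| "sim T A Z v (WhilePos r P) = WhilePos r (sim T A Z v P)"

section \<open>Correctness and linear slowdown of the simulation\<close>

text \<open>
  A is a register for addresses, Z holds the time stamp of the current run, and v computes the
  input of the run at the address in A; g gives the constant values of the registers from R on.
\<close>
locale simulation =
  fixes R A Z T a b :: nat and v :: expr and BP X :: int
    and g :: "nat \<Rightarrow> int" and inp vin :: "int \<Rightarrow> int"
  assumes regs: "R \<le> A" "A < T" "R \<le> Z" "Z < T" "A \<noteq> Z"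
    and X: "X \<ge> 2" and BP: "BP \<le> X ^ a"
    and ab: "a \<le> b" "ebound a (load_e A Z v) \<le> b" "ebound a (tag_e A) \<le> b"
    and wf_v: "wf_expr T v"
    and eval_v: "\<And>\<rho> m. (\<And>r. R \<le> r \<Longrightarrow> r < T \<Longrightarrow> r \<noteq> A \<Longrightarrow> \<rho> r = g r) \<Longrightarrow>
       (\<And>c. c \<ge> 0 \<Longrightarrow> m c = inp c) \<Longrightarrow> eval (\<rho>, m) v = vin (\<rho> A)"
    and g_bound: "\<And>r. R \<le> r \<Longrightarrow> r < T \<Longrightarrow> \<bar>g r\<bar> \<le> X ^ a"
begin

text \<open>Instances run with decreasing stamps, so old stamps are larger than \<open>g Z\<close>
  and 0 means never written. The last conjunct hands this on to the next instance.\<close>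

definition mem_rel :: "(int \<Rightarrow> int) \<Rightarrow> (int \<Rightarrow> int) \<Rightarrow> bool" where
  "mem_rel m \<mu> \<longleftrightarrow>
     (\<forall>c. \<bar>m c\<bar> \<le> BP) \<and> (\<forall>c. \<bar>\<mu> c\<bar> \<le> X ^ a) \<and> (\<forall>c\<ge>0. \<mu> c = inp c) \<and>
     (\<forall>c. m c = (if \<mu> (loc c - 1) = g Z then \<mu> (loc c) else vin c)) \<and>
     (\<forall>c. \<mu> (loc c - 1) = 0 \<or> \<mu> (loc c - 1) \<ge> g Z)"

definition rel :: "state \<Rightarrow> state \<Rightarrow> bool" where
  "rel s \<sigma> \<longleftrightarrow>
     (\<forall>r<R. fst \<sigma> r = fst s r \<and> \<bar>fst s r\<bar> \<le> BP) \<and>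
     (\<forall>r. R \<le> r \<longrightarrow> r < T \<longrightarrow> r \<noteq> A \<longrightarrow> fst \<sigma> r = g r) \<and>
     \<bar>fst \<sigma> A\<bar> \<le> X ^ a \<and> mem_rel (snd s) (snd \<sigma>)"

text \<open>One constant for all kinds of instructions; being positive, it also absorbs the unit for
  each test.\<close>

definition "slow = cost (load_e A Z v) + cost (loc_e A) + cost (tag_e A) + 6"

lemma rel_regs:
  assumes "rel s \<sigma>" "r < T"
  shows "\<bar>fst \<sigma> r\<bar> \<le> X ^ a"
proof -
  consider "r < R" | "r = A" | "R \<le> r" "r \<noteq> A" by linarith
  then show ?thesis
  proof cases
    case 1
    then have "\<bar>fst \<sigma> r\<bar> \<le> BP" using assms(1) unfolding rel_def by simp
    then show ?thesis using BP by linarith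
  qed (use assms g_bound[of r] in \<open>auto simp: rel_def\<close>)
qed

lemma fits_rel:
  assumes "rel s \<sigma>" "wf_expr T e" "ebound a e \<le> b"
  shows "fits (X ^ b) \<sigma> e"
  using fits_poly[OF X assms(2) _ _ assms(3), of \<sigma>] rel_regs[OF assms(1)] assms(1)
  unfolding rel_def mem_rel_def by blast

lemma rel_set_addr:
  "rel s \<sigma> \<Longrightarrow> \<bar>c\<bar> \<le> X ^ a \<Longrightarrow> rel s ((fst \<sigma>)(A := c), snd \<sigma>)"
  using regs unfolding rel_def by auto

lemma runs_addr:
  assumes "rel s \<sigma>" "p < R"
  shows "runs T (X ^ b) (assign T A (Var p)) \<sigma> 2 ((fst \<sigma>)(A := fst s p), snd \<sigma>)"
    and "rel s ((fst \<sigma>)(A := fst s p), snd \<sigma>)"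
proof -
  have p: "p < T" "fst \<sigma> p = fst s p" "\<bar>fst s p\<bar> \<le> X ^ a"
    using assms regs rel_regs[OF assms(1), of p] unfolding rel_def by auto
  show "rel s ((fst \<sigma>)(A := fst s p), snd \<sigma>)" using rel_set_addr[OF assms(1) p(3)] .
  show "runs T (X ^ b) (assign T A (Var p)) \<sigma> 2 ((fst \<sigma>)(A := fst s p), snd \<sigma>)"
    using runs_assign[of T "Var p" "X ^ b" \<sigma> A] fits_rel[OF assms(1), of "Var p"] p regs ab
    by (simp add: numeral_2_eq_2)
qed

lemma BP_le: "BP \<le> X ^ b"
  using BP power_increasing[of a b X] ab X by linarith

lemma sim_instr:
  assumes "exec_instr BP i s s'" "instr_below R i" "rel s \<sigma>"
  shows "\<exists>\<sigma>'. runs T (X ^ b) (sim_instr T A Z v i) \<sigma> slow \<sigma>' \<and> rel s' \<sigma>'"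
  using assms(1)
proof cases
  case (1 c r \<rho> m)
  have r: "r < R" "r < T" using assms(2) 1 regs by auto
  have "runs T (X ^ b) (Instr (Const r c)) \<sigma> 1 ((fst \<sigma>)(r := c), snd \<sigma>)"
    unfolding runs_def
  proof (intro allI impI)
    fix \<rho>1 assume \<rho>1: "\<forall>r<T. \<rho>1 r = fst \<sigma> r"
    have "exec (X ^ b) (Instr (Const r c)) (\<rho>1, snd \<sigma>) 1 (\<rho>1(r := c), snd \<sigma>)"
      using 1 BP_le by (intro exec.Instr exec_instr.intros) auto
    moreover have "\<forall>q<T. (\<rho>1(r := c)) q = ((fst \<sigma>)(r := c)) q" using \<rho>1 by simp
    ultimately show "\<exists>\<rho>' k. exec (X ^ b) (Instr (Const r c)) (\<rho>1, snd \<sigma>) k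
        (\<rho>', snd ((fst \<sigma>)(r := c), snd \<sigma>)) \<and> k \<le> 1 \<and>
        (\<forall>q<T. \<rho>' q = fst ((fst \<sigma>)(r := c), snd \<sigma>) q)"
      unfolding fst_conv snd_conv by blast
  qed
  moreover have "rel s' ((fst \<sigma>)(r := c), snd \<sigma>)"
    using assms(3) 1 r regs unfolding rel_def by auto
  ultimately show ?thesis
    using runs_mono[of T _ _ \<sigma> 1 _ slow] 1 unfolding slow_def
    by (metis sim_instr.simps(1) le_add2 one_le_numeral le_trans)
next
  case (2 x f \<rho> p q r m)
  have r: "r < R" "p < R" "q < R" using assms(2) 2 by auto
  then have pq: "fst \<sigma> p = \<rho> p" "fst \<sigma> q = \<rho> q" using assms(3) 2 unfolding rel_def by auto
  have "runs T (X ^ b) (Instr (Op f r p q)) \<sigma> 1 ((fst \<sigma>)(r := x), snd \<sigma>)"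
    unfolding runs_def
  proof (intro allI impI)
    fix \<rho>1 assume \<rho>1: "\<forall>r<T. \<rho>1 r = fst \<sigma> r"
    have "\<rho>1 p = \<rho> p" "\<rho>1 q = \<rho> q" using r regs \<rho>1 pq by auto
    then have "exec (X ^ b) (Instr (Op f r p q)) (\<rho>1, snd \<sigma>) 1 (\<rho>1(r := x), snd \<sigma>)"
      using 2 BP_le by (intro exec.Instr exec_instr.intros) auto
    moreover have "\<forall>q<T. (\<rho>1(r := x)) q = ((fst \<sigma>)(r := x)) q" using \<rho>1 by simp
    ultimately show "\<exists>\<rho>' k. exec (X ^ b) (Instr (Op f r p q)) (\<rho>1, snd \<sigma>) k
        (\<rho>', snd ((fst \<sigma>)(r := x), snd \<sigma>)) \<and> k \<le> 1 \<and>
        (\<forall>q<T. \<rho>' q = fst ((fst \<sigma>)(r := x), snd \<sigma>) q)"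
      unfolding fst_conv snd_conv by blast
  qed
  moreover have "rel s' ((fst \<sigma>)(r := x), snd \<sigma>)"
    using assms(3) 2 r regs unfolding rel_def by auto
  ultimately show ?thesis
    using runs_mono[of T _ _ \<sigma> 1 _ slow] 2 unfolding slow_def
    by (metis sim_instr.simps(2) le_add2 one_le_numeral le_trans)
next
  case (3 r p \<rho> m)
  have r: "r < R" "p < R" "r < T" using assms(2) 3 regs by auto
  define \<tau> where "\<tau> = ((fst \<sigma>)(A := \<rho> p), snd \<sigma>)"
  have \<tau>: "runs T (X ^ b) (assign T A (Var p)) \<sigma> 2 \<tau>" "rel s \<tau>"
    using runs_addr[OF assms(3) r(2)] 3 unfolding \<tau>_def by auto
  have "eval \<tau> v = vin (\<rho> p)"
    using eval_v[of "fst \<tau>" "snd \<tau>"] \<tau>(2) unfolding rel_def mem_rel_def \<tau>_def by auto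
  then have ev: "eval \<tau> (load_e A Z v) = m (\<rho> p)"
    using \<tau>(2) 3 regs unfolding rel_def mem_rel_def by (simp add: load_e_def \<tau>_def)
  have wf: "wf_expr T (load_e A Z v)" using wf_v regs by (simp add: load_e_def)
  have "runs T (X ^ b) (assign T r (load_e A Z v)) \<tau> (cost (load_e A Z v) + 1)
      ((fst \<tau>)(r := m (\<rho> p)), snd \<tau>)"
    using runs_assign[OF wf fits_rel[OF \<tau>(2) wf ab(2)] r(3)] ev by simp
  moreover have "rel s' ((fst \<tau>)(r := m (\<rho> p)), snd \<tau>)"
  proof -
    \<comment> \<open>A load has no check of its own against the word bound; the value fits because
      \<open>mem_rel\<close> bounds the whole simulated memory.\<close>
    have "\<bar>m (\<rho> p)\<bar> \<le> BP" using \<tau>(2) 3(2) unfolding rel_def mem_rel_def by (metis snd_conv)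
    then show ?thesis using \<tau>(2) 3 r regs unfolding rel_def by auto
  qed
  moreover have "2 + (cost (load_e A Z v) + 1) \<le> slow" by (simp add: slow_def)
  ultimately show ?thesis
    using runs_mono[OF runs_Seq[OF \<tau>(1)], of _ _ _ slow] 3 by (metis sim_instr.simps(3))
next
  case (4 p r \<rho> m)
  have r: "r < R" "p < R" "r < T" "p < T" using assms(2) 4 regs by auto
  define \<tau> where "\<tau> = ((fst \<sigma>)(A := \<rho> p), snd \<sigma>)"
  have \<tau>: "runs T (X ^ b) (assign T A (Var p)) \<sigma> 2 \<tau>" "rel s \<tau>"
    using runs_addr[OF assms(3) r(2)] 4 unfolding \<tau>_def by auto
  have \<tau>A: "fst \<tau> A = \<rho> p" "fst \<tau> r = \<rho> r" "fst \<tau> Z = g Z"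
    using \<tau>(2) 4 r regs unfolding rel_def by (auto simp: \<tau>_def)
  have wf: "wf_expr T (loc_e A)" "wf_expr T (tag_e A)" using regs by auto
  have ab': "ebound a (loc_e A) \<le> b" using ab by (simp add: tag_e_def)
  define m1 where "m1 = (snd \<tau>)(loc (\<rho> p) := \<rho> r)"
  have 1: "runs T (X ^ b) (store T (loc_e A) r) \<tau> (cost (loc_e A) + 1) (fst \<tau>, m1)"
    using runs_store[OF wf(1) fits_rel[OF \<tau>(2) wf(1) ab'] r(3)] \<tau>A by (simp add: m1_def)
  have "\<bar>\<rho> r\<bar> \<le> X ^ a" using assms(3) 4 r BP unfolding rel_def by fastforce
  then have m1: "\<forall>c. \<bar>m1 c\<bar> \<le> X ^ a" using \<tau>(2) unfolding rel_def mem_rel_def m1_def by auto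
  have "fits (X ^ b) (fst \<tau>, m1) (tag_e A)"
    using fits_poly[OF X wf(2) _ _ ab(3), of "(fst \<tau>, m1)"] rel_regs[OF \<tau>(2)] m1 by simp
  then have 2: "runs T (X ^ b) (store T (tag_e A) Z) (fst \<tau>, m1) (cost (tag_e A) + 1)
      (fst \<tau>, m1(loc (\<rho> p) - 1 := g Z))"
    using runs_store[OF wf(2), of "X ^ b" "(fst \<tau>, m1)" Z] regs \<tau>A by simp
  have gZ: "\<bar>g Z\<bar> \<le> X ^ a" using g_bound regs by simp
  have \<mu>: "mem_rel m (snd \<tau>)" using \<tau>(2) 4 unfolding rel_def by simp
  have \<rho>r: "\<bar>\<rho> r\<bar> \<le> BP" using assms(3) 4 r unfolding rel_def by simp
  let ?\<mu> = "m1(loc (\<rho> p) - 1 := g Z)"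
  \<comment> \<open>By disjointness of the addresses, the two stores affect the value and stamp of
    the simulated cell \<open>\<rho> p\<close> only.\<close>
  have tag: "?\<mu> (loc c - 1) = (if c = \<rho> p then g Z else snd \<tau> (loc c - 1))"
    "?\<mu> (loc c) = (if c = \<rho> p then \<rho> r else snd \<tau> (loc c))" for c
    using loc_neq_tag[of "\<rho> p" c] loc_neq_tag[of c "\<rho> p"] loc_eq_iff[of c "\<rho> p"]
    by (auto simp: m1_def)
  have "mem_rel (m(\<rho> p := \<rho> r)) ?\<mu>"
    unfolding mem_rel_def tag
  proof (intro conjI allI impI)
    fix c
    show "\<bar>(m(\<rho> p := \<rho> r)) c\<bar> \<le> BP" using \<mu> \<rho>r unfolding mem_rel_def by (metis fun_upd_apply)
    show "\<bar>?\<mu> c\<bar> \<le> X ^ a" using m1 gZ by simp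
    show "?\<mu> c = inp c" if "c \<ge> 0"
      using \<mu> that loc_neg[of "\<rho> p"] unfolding mem_rel_def m1_def by auto
    show "(m(\<rho> p := \<rho> r)) c = (if (if c = \<rho> p then g Z else snd \<tau> (loc c - 1)) = g Z
        then if c = \<rho> p then \<rho> r else snd \<tau> (loc c) else vin c)"
      using \<mu> unfolding mem_rel_def by (metis fun_upd_apply)
    show "(if c = \<rho> p then g Z else snd \<tau> (loc c - 1)) = 0 \<or>
        g Z \<le> (if c = \<rho> p then g Z else snd \<tau> (loc c - 1))"
      using \<mu> unfolding mem_rel_def by simp
  qed
  then have "rel s' (fst \<tau>, ?\<mu>)" using \<tau>(2) 4 unfolding rel_def by simp
  moreover have "2 + (cost (loc_e A) + 1 + (cost (tag_e A) + 1)) \<le> slow" by (simp add: slow_def)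
  ultimately show ?thesis
    using runs_mono[OF runs_Seq[OF \<tau>(1) runs_Seq[OF 1 2]], of slow] 4
    by (metis sim_instr.simps(4))
qed

lemma sim:
  assumes "exec BP P s k s'" "prog_below R P" "rel s \<sigma>"
  shows "\<exists>\<sigma>'. runs T (X ^ b) (sim T A Z v P) \<sigma> (slow * k) \<sigma>' \<and> rel s' \<sigma>'"
  using assms
proof (induction arbitrary: \<sigma> rule: exec.induct)
  case (Instr i s s')
  then show ?case using sim_instr[of i s s' \<sigma>] by simp
next
  case (Seq P s k s' Q l s'')
  then obtain \<sigma>1 where 1: "runs T (X ^ b) (sim T A Z v P) \<sigma> (slow * k) \<sigma>1" "rel s' \<sigma>1" by fastforce
  then obtain \<sigma>2 where 2: "runs T (X ^ b) (sim T A Z v Q) \<sigma>1 (slow * l) \<sigma>2" "rel s'' \<sigma>2"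
    using Seq by fastforce
  then show ?case using runs_Seq[OF 1(1) 2(1)] by (metis sim.simps(2) distrib_left)
next
  case (IfTrue s r P k s' Q)
  then obtain \<sigma>1 where 1: "runs T (X ^ b) (sim T A Z v P) \<sigma> (slow * k) \<sigma>1" "rel s' \<sigma>1" by fastforce
  have "r < T" "fst \<sigma> r > 0" using IfTrue regs unfolding rel_def by auto
  then have "runs T (X ^ b) (sim T A Z v (IfPos r P Q)) \<sigma> (slow * k + 1) \<sigma>1"
    using runs_IfPos[of r T "X ^ b" \<sigma> "sim T A Z v P" "sim T A Z v Q"] 1 by simp
  moreover have "slow * k + 1 \<le> slow * (k + 1)" by (simp add: slow_def)
  ultimately show ?case using 1(2) runs_mono[of T _ _ \<sigma>] by (metis sim.simps(3))
next
  case (IfFalse s r Q k s' P)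
  then obtain \<sigma>1 where 1: "runs T (X ^ b) (sim T A Z v Q) \<sigma> (slow * k) \<sigma>1" "rel s' \<sigma>1" by fastforce
  have "r < T" "\<not> fst \<sigma> r > 0" using IfFalse regs unfolding rel_def by auto
  then have "runs T (X ^ b) (sim T A Z v (IfPos r P Q)) \<sigma> (slow * k + 1) \<sigma>1"
    using runs_IfPos[of r T "X ^ b" \<sigma> "sim T A Z v P" "sim T A Z v Q"] 1 by simp
  moreover have "slow * k + 1 \<le> slow * (k + 1)" by (simp add: slow_def)
  ultimately show ?case using 1(2) runs_mono[of T _ _ \<sigma>] by (metis sim.simps(3))
next
  case (WhileFalse s r P)
  have "r < T" "fst \<sigma> r \<le> 0" using WhileFalse regs unfolding rel_def by auto
  then have "runs T (X ^ b) (sim T A Z v (WhilePos r P)) \<sigma> 1 \<sigma>"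
    using runs_WhileFalse by simp
  moreover have "1 \<le> slow * 1" by (simp add: slow_def)
  ultimately show ?case using WhileFalse(3) runs_mono[of T _ _ \<sigma>] by (metis sim.simps(4))
next
  case (WhileTrue s r P k s' l s'')
  then obtain \<sigma>1 where 1: "runs T (X ^ b) (sim T A Z v P) \<sigma> (slow * k) \<sigma>1" "rel s' \<sigma>1" by fastforce
  then obtain \<sigma>2 where 2: "runs T (X ^ b) (sim T A Z v (WhilePos r P)) \<sigma>1 (slow * l) \<sigma>2" "rel s'' \<sigma>2"
    using WhileTrue by fastforce
  have "r < T" "fst \<sigma> r > 0" using WhileTrue regs unfolding rel_def by auto
  then have "runs T (X ^ b) (sim T A Z v (WhilePos r P)) \<sigma> (slow * k + slow * l + 1) \<sigma>2"
    using runs_WhileTrue[OF _ _ 1(1)] 2 by simp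
  moreover have "slow * k + slow * l + 1 \<le> slow * (k + l + 1)"
    by (simp add: slow_def algebra_simps)
  ultimately show ?case using 2(2) runs_mono[of T _ _ \<sigma>] by (metis sim.simps(4))
qed

end

section \<open>The graph reduction\<close>

text \<open>Copies of H are images of injective homomorphisms g, the inverses of the isomorphisms.
  Injectivity on nodes makes g injective on edges too, so each weight is summed once.\<close>

lemma exact_weight_iff:
  assumes H: "simple_graph H"
  shows "exact_weight H G w t \<longleftrightarrow>
     (\<exists>g. inj_on g (verts H) \<and> g ` verts H \<subseteq> verts G \<and> (\<forall>e\<in>edges H. g ` e \<in> edges G) \<and>
        (\<Sum>e\<in>edges H. w (g ` e)) = t)"
proof
  assume "exact_weight H G w t"
  then obtain S f where S: "subgraph_of S G" "(\<Sum>e\<in>edges S. w e) = t"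
    and f: "bij_betw f (verts S) (verts H)" "edges H = (\<lambda>e. f ` e) ` edges S"
    unfolding exact_weight_def graph_iso_def by blast
  define g where "g = inv_into (verts S) f"
  have g: "bij_betw g (verts H) (verts S)" unfolding g_def using f(1) by (rule bij_betw_inv_into)
  have S_sub: "e \<subseteq> verts S" if "e \<in> edges S" for e
    using S(1) that unfolding subgraph_of_def simple_graph_def by blast
  have gf: "g ` f ` e = e" if "e \<in> edges S" for e
    using S_sub[OF that] f(1) unfolding g_def by (meson bij_betw_imp_inj_on inv_into_image_cancel)
  have "inj_on (\<lambda>e. f ` e) (edges S)" by (metis inj_onI gf)
  then have "(\<Sum>e\<in>edges H. w (g ` e)) = (\<Sum>e\<in>edges S. w (g ` f ` e))"
    using f(2) by (simp add: sum.reindex)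
  also have "\<dots> = t" using gf S(2) by (metis (mono_tags, lifting) sum.cong)
  finally have "(\<Sum>e\<in>edges H. w (g ` e)) = t" .
  moreover have "inj_on g (verts H)" using g by (rule bij_betw_imp_inj_on)
  moreover have "g ` verts H \<subseteq> verts G"
    using g S(1) unfolding bij_betw_def subgraph_of_def by blast
  moreover have "\<forall>e\<in>edges H. g ` e \<in> edges G"
    using f(2) gf S(1) unfolding subgraph_of_def by auto
  ultimately show "\<exists>g. inj_on g (verts H) \<and> g ` verts H \<subseteq> verts G \<and>
      (\<forall>e\<in>edges H. g ` e \<in> edges G) \<and> (\<Sum>e\<in>edges H. w (g ` e)) = t" by blast
next
  assume "\<exists>g. inj_on g (verts H) \<and> g ` verts H \<subseteq> verts G \<and>
      (\<forall>e\<in>edges H. g ` e \<in> edges G) \<and> (\<Sum>e\<in>edges H. w (g ` e)) = t"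
  then obtain g where g: "inj_on g (verts H)" "g ` verts H \<subseteq> verts G"
    "\<forall>e\<in>edges H. g ` e \<in> edges G" "(\<Sum>e\<in>edges H. w (g ` e)) = t" by blast
  define S where "S = (g ` verts H, (\<lambda>e. g ` e) ` edges H)"
  have H_sub: "e \<subseteq> verts H" "card e = 2" if "e \<in> edges H" for e
    using H that unfolding simple_graph_def by auto
  have inj: "inj_on (\<lambda>e. g ` e) (edges H)"
    using inj_on_image_Pow[OF g(1)] H_sub(1) by (auto intro: inj_on_subset)
  have "card (g ` e) = 2" if "e \<in> edges H" for e
    using H_sub[OF that] g(1) by (metis card_image inj_on_subset)
  then have "subgraph_of S G"
    using H g(2,3) image_mono[OF H_sub(1), of _ g]
    unfolding subgraph_of_def simple_graph_def S_def by (auto; blast)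
  moreover have "graph_iso S H"
    unfolding graph_iso_def
  proof (intro exI conjI)
    show "bij_betw (inv_into (verts H) g) (verts S) (verts H)"
      using g(1) by (simp add: S_def bij_betw_inv_into inj_on_imp_bij_betw)
    have "inv_into (verts H) g ` g ` e = e" if "e \<in> edges H" for e
      using inv_into_image_cancel[OF g(1) H_sub(1)[OF that]] .
    then show "edges H = (\<lambda>e. inv_into (verts H) g ` e) ` edges S"
      by (auto simp: S_def image_image)
  qed
  moreover have "(\<Sum>e\<in>edges S. w e) = t"
    using inj g(4) by (simp add: S_def sum.reindex)
  ultimately show "exact_weight H G w t" unfolding exact_weight_def by blast
qed

text \<open>Modulo N only the lowest digit remains, and a multiple of N smaller than N in absolute
  value is 0; then divide by N. Digits may be negative, and the top one is unbounded, which makes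
  room for arbitrary weights.\<close>

lemma sum_powers_zero:
  fixes f :: "nat \<Rightarrow> int"
  assumes "(\<Sum>i<Suc C. f i * N ^ i) = 0" "\<And>i. i < C \<Longrightarrow> \<bar>f i\<bar> < N" "i \<le> C"
  shows "f i = 0"
  using assms
proof (induction C arbitrary: f i)
  case 0
  then show ?case by simp
next
  case (Suc C)
  have eq: "f 0 + N * (\<Sum>i<Suc C. f (Suc i) * N ^ i) = 0"
    using Suc.prems(1) by (subst (asm) sum.lessThan_Suc_shift)
      (simp only: sum_distrib_left power_0 power_Suc mult.assoc mult.left_commute mult_1_right)
  then have "N dvd f 0"
    by (metis add.commute dvd_add_right_iff dvd_triv_left dvd_0_right)
  then have f0: "f 0 = 0" using Suc.prems(2)[of 0] by (metis abs_if abs_eq_0 zdvd_not_zless zero_less_Suc zero_less_abs_iff dvd_abs_iff)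
  have "N > 0" using Suc.prems(2)[of 0] by auto
  then have "(\<Sum>i<Suc C. f (Suc i) * N ^ i) = 0" using eq f0 by simp
  then have "f (Suc j) = 0" if "j \<le> C" for j
    using Suc.IH[of "\<lambda>i. f (Suc i)" j] Suc.prems(2) that by simp
  then show ?case using f0 Suc.prems(3) by (cases i) auto
qed

text \<open>All guesses are packed into one number, which serves at once as loop counter, instance
  index and time stamp.\<close>

lemma ex_digits:
  fixes D :: nat
  assumes "\<And>l. l < K \<Longrightarrow> d l < D"
  shows "\<exists>z<D ^ K. \<forall>l<K. z div D ^ l mod D = d l"
  using assms
proof (induction K)
  case (Suc K)
  then obtain z where z: "z < D ^ K" "\<forall>l<K. z div D ^ l mod D = d l" by auto
  have D: "D > 0" using Suc.prems[of 0] by simp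
  define z' where "z' = z + D ^ K * d K"
  have "z' < D ^ K * (d K + 1)" using z(1) by (simp add: z'_def)
  also have "\<dots> \<le> D ^ K * D" using Suc.prems[of K] by (intro mult_left_mono) auto
  finally have "z' < D ^ Suc K" by (simp add: mult.commute)
  moreover have "z' div D ^ l mod D = d l" if "l < Suc K" for l
  proof (cases "l = K")
    case True
    then show ?thesis using z(1) D Suc.prems[of K] by (simp add: z'_def)
  next
    case False
    then have l: "l < K" using that by simp
    then have "D ^ K = D ^ l * (D * D ^ (K - l - 1))"
      by (metis Suc_diff_Suc diff_Suc_eq_diff_pred diff_commute diff_diff_left le_add_diff_inverse
          less_imp_le_nat plus_1_eq_Suc power_Suc power_add add.commute)
    then have "z' = z + D ^ l * (D * (D ^ (K - l - 1) * d K))" by (simp add: z'_def mult.assoc)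
    then have "z' div D ^ l = z div D ^ l + D * (D ^ (K - l - 1) * d K)" using D by simp
    then show ?thesis using z(2) l by simp
  qed
  ultimately show ?case by blast
qed simp

text \<open>The index d encodes the guess of a bit position and of whether that bit is flipped.\<close>
definition bitf :: "nat \<Rightarrow> nat \<Rightarrow> nat" where
  "bitf d x = (x div 2 ^ (d div 2) + d) mod 2"

lemma ex_bitf:
  assumes "x \<noteq> y" "x < 2 ^ L" "y < 2 ^ L"
  shows "\<exists>d<2 * L. bitf d x = 0 \<and> bitf d y = 1"
proof -
  obtain b where b: "bit x b \<noteq> bit y b" using assms(1) by (auto simp: bit_eq_iff)
  have "b < L"
  proof (rule ccontr)
    assume "\<not> b < L"
    then have "(2::nat) ^ L \<le> 2 ^ b" by simp
    then have "x div 2 ^ b = 0" "y div 2 ^ b = 0"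
      using assms(2,3) by (meson div_less less_le_trans)+
    then show False using b by (simp add: bit_iff_odd)
  qed
  \<comment> \<open>Halving d recovers the position b, and the low bit of d, taken equal to bit b of
    x, is added to the bit read: x gives 0, and y, which differs there, gives 1.\<close>
  define d where "d = 2 * b + x div 2 ^ b mod 2"
  have "d < 2 * L" "d div 2 = b" using \<open>b < L\<close> by (auto simp: d_def)
  moreover have "(u + (2 * b + u mod 2)) mod 2 = 0" "odd u \<noteq> odd v \<Longrightarrow> (v + (2 * b + u mod 2)) mod 2 = 1"
    for u v :: nat by presburger+
  then have "(x div 2 ^ b + d) mod 2 = 0" "(y div 2 ^ b + d) mod 2 = 1"
    using b unfolding d_def bit_iff_odd by blast+
  ultimately show ?thesis unfolding bitf_def by metis
qed

text \<open>A copy of H2 determines the values only on those nodes of H1 that lie under ends of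
  edges; this places the remaining ones.\<close>

lemma ex_inj_extension:
  fixes f :: "nat \<Rightarrow> nat"
  assumes "inj_on f I" "I \<subseteq> {..<k}" "f ` I \<subseteq> {..<n}" "k \<le> n"
  shows "\<exists>g. inj_on g {..<k} \<and> g ` {..<k} \<subseteq> {..<n} \<and> (\<forall>i\<in>I. g i = f i)"
proof -
  have fin: "finite I" using assms(2) finite_subset by blast
  have "card ({..<k} - I) \<le> card ({..<n} - f ` I)"
    using assms fin by (simp add: card_Diff_subset card_image)
  then obtain f' where f': "inj_on f' ({..<k} - I)" "f' ` ({..<k} - I) \<subseteq> {..<n} - f ` I"
    using card_le_inj[of "{..<k} - I" "{..<n} - f ` I"] by auto
  define g where "g i = (if i \<in> I then f i else f' i)" for i
  have g_I: "g ` I = f ` I" "g ` ({..<k} - I) = f' ` ({..<k} - I)" by (auto simp: g_def)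
  have "inj_on g I" "inj_on g ({..<k} - I)"
    using assms(1) f'(1) by (auto simp: inj_on_def g_def)
  moreover have "g ` I \<inter> g ` ({..<k} - I) = {}" using f'(2) unfolding g_I by blast
  moreover have "{..<k} = I \<union> ({..<k} - I)" using assms(2) by blast
  moreover have "I - ({..<k} - I) = I" "({..<k} - I) - I = {..<k} - I" by blast+
  ultimately have "inj_on g {..<k}" by (metis inj_on_Un)
  moreover have "g ` {..<k} \<subseteq> {..<n}" using assms(3) f'(2) by (auto simp: g_def)
  moreover have "\<forall>i\<in>I. g i = f i" by (simp add: g_def)
  ultimately show ?thesis by blast
qed

text \<open>Normal form of the covering: nodes are numbered and each edge of H2 is listed once with
  its smaller end first, so that it has a definite source and target. Edges of H2 may go to loops or
  to non-edges of H1.\<close>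

locale reduction =
  fixes k h :: nat and els :: "(nat \<times> nat) list" and \<phi> :: "nat \<Rightarrow> nat" and E1 :: "nat set set"
  assumes els_distinct: "distinct els"
    and els_less: "(u, v) \<in> set els \<Longrightarrow> u < v \<and> v < h"
    and \<phi>_surj: "\<phi> ` {..<h} = {..<k}"
    and simple_E1: "simple_graph ({..<k}, E1)"
    and E1_sub: "e \<in> E1 \<Longrightarrow> \<exists>(u, v)\<in>set els. e = {\<phi> u, \<phi> v}"
begin

abbreviation "m \<equiv> length els"
abbreviation "src c \<equiv> fst (els ! c)"
abbreviation "dst c \<equiv> snd (els ! c)"

definition "E2 = {{u, v} | u v. (u, v) \<in> set els}"
definition "img c = {\<phi> (src c), \<phi> (dst c)}"
text \<open>Taking the first class over an edge of H1 makes the designated classes correspond one to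
  one to E1, so no weight is counted twice.\<close>

definition "des c \<longleftrightarrow> img c \<in> E1 \<and> (\<forall>c'<c. img c' \<noteq> img c)"
definition "node s c = (if s then dst c else src c)"
definition "val s x y = (if s then y else x)"
text \<open>An incidence is a pair of a side (\<open>True\<close> for the target end) and a class.
  The choice is meaningful only for i under some end of an edge, see \<open>ref\<close>.\<close>

definition "ref i = (SOME p. snd p < m \<and> \<phi> (node (fst p) (snd p)) = i)"

text \<open>
  Over an edge of class c with ends x and y, digit i of the weight (in base \<open>base n\<close>) is: for i < m, the
  indicator of class i; then, for each of the 2 m incidences (s, l), the copied node at that
  incidence minus the one at the reference incidence of the same node of H1; at the top, the weight.
\<close>
definition inc :: "bool \<Rightarrow> nat \<Rightarrow> nat \<Rightarrow> nat \<Rightarrow> nat \<Rightarrow> int" where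
  "inc s l c x y = (if c = l then int (val s x y) else 0) -
     (if c = snd (ref (\<phi> (node s l))) then int (val (fst (ref (\<phi> (node s l)))) x y) else 0)"

definition dig :: "(nat set \<Rightarrow> int) \<Rightarrow> nat \<Rightarrow> nat \<Rightarrow> nat \<Rightarrow> nat \<Rightarrow> int" where
  "dig w i c x y =
     (if i < m then of_bool (c = i) else if i < 2 * m then inc False (i - m) c x y
      else if i < 3 * m then inc True (i - 2 * m) c x y else if des c then w {x, y} else 0)"

definition tdig :: "int \<Rightarrow> nat \<Rightarrow> int" where
  "tdig t i = (if i < m then 1 else if i < 3 * m then 0 else t)"

text \<open>The m summands in a low digit have absolute value at most n + 1, so the sum is at most
  \<open>base n - (n + 1)\<close>, with room for the target digit 1 as soon as n > 0.\<close>

definition base :: "nat \<Rightarrow> int" where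
  "base n = int (m + 1) * (int n + 1)"

definition wt :: "nat \<Rightarrow> (nat set \<Rightarrow> int) \<Rightarrow> nat \<Rightarrow> nat \<Rightarrow> nat \<Rightarrow> int" where
  "wt n w c x y = (\<Sum>i<Suc (3 * m). dig w i c x y * base n ^ i)"

definition tgt :: "nat \<Rightarrow> int \<Rightarrow> int" where
  "tgt n t = (\<Sum>i<Suc (3 * m). tdig t i * base n ^ i)"

text \<open>For i < j, the digit of z at position i * k + j is the test separating the two: colour i
  must read 0 and colour j must read 1. Hence no x has two colours.\<close>

definition col :: "nat \<Rightarrow> nat \<Rightarrow> nat \<Rightarrow> nat \<Rightarrow> bool" where
  "col D z i x \<longleftrightarrow> (\<forall>j<k. (i < j \<longrightarrow> bitf (z div D ^ (i * k + j) mod D) x = 0) \<and>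
     (j < i \<longrightarrow> bitf (z div D ^ (j * k + i) mod D) x = 1))"

text \<open>Only designated classes look at E. All others are complete between the admissible
  colours, so that they never obstruct a copy.\<close>

definition ok :: "nat set set \<Rightarrow> nat \<Rightarrow> nat \<Rightarrow> nat \<Rightarrow> nat \<Rightarrow> nat \<Rightarrow> bool" where
  "ok E D z c x y \<longleftrightarrow> col D z (\<phi> (src c)) x \<and> col D z (\<phi> (dst c)) y \<and> (des c \<longrightarrow> {x, y} \<in> E)"

text \<open>The copy (u, x) is the number u * n + x; quotient and remainder by n give back the layer
  and the node.\<close>

definition flag :: "nat \<Rightarrow> nat set set \<Rightarrow> nat \<Rightarrow> nat \<Rightarrow> nat \<Rightarrow> nat \<Rightarrow> bool" where
  "flag n E D z p q \<longleftrightarrow>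
     (\<exists>c<m. src c = p div n \<and> dst c = q div n \<and> ok E D z c (p mod n) (q mod n))"

definition Wt :: "nat \<Rightarrow> (nat set \<Rightarrow> int) \<Rightarrow> nat \<Rightarrow> nat \<Rightarrow> int" where
  "Wt n w p q =
     (\<Sum>c<m. if src c = p div n \<and> dst c = q div n then wt n w c (p mod n) (q mod n) else 0)"

text \<open>Layer h contains no edge, because targets are below h. It keeps the number of nodes at
  least n even for h = 0, so that it tends to infinity with n.\<close>

definition newE :: "nat \<Rightarrow> nat set set \<Rightarrow> nat \<Rightarrow> nat \<Rightarrow> nat set set" where
  "newE n E D z = {{p, q} | p q. p < q \<and> q < (h + 1) * n \<and> flag n E D z p q}"

text \<open>Sources lie in lower layers than targets, so the smaller end of an edge is its source
  copy and the orientation is recovered.\<close>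

definition neww :: "nat \<Rightarrow> (nat set \<Rightarrow> int) \<Rightarrow> nat set \<Rightarrow> int" where
  "neww n w e = Wt n w (Min e) (Max e)"

lemma els_nth: "c < m \<Longrightarrow> src c < dst c" "c < m \<Longrightarrow> dst c < h"
  using els_less[of "src c" "dst c"] nth_mem[of c els] by auto

lemma els_nth_eq: "c < m \<Longrightarrow> c' < m \<Longrightarrow> src c = src c' \<Longrightarrow> dst c = dst c' \<Longrightarrow> c = c'"
  using els_distinct by (metis nth_eq_iff_index_eq prod.expand)

lemma \<phi>_node: "c < m \<Longrightarrow> \<phi> (node s c) < k"
  using \<phi>_surj els_nth[of c] by (auto simp: node_def)

lemma ref:
  assumes "c < m" "\<phi> (node s c) = i"
  shows "snd (ref i) < m" "\<phi> (node (fst (ref i)) (snd (ref i))) = i"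
  using someI[of "\<lambda>p. snd p < m \<and> \<phi> (node (fst p) (snd p)) = i" "(s, c)"] assms
  unfolding ref_def by auto

lemma bij_E2: "bij_betw (\<lambda>c. {src c, dst c}) {..<m} E2"
    unfolding bij_betw_def
  proof
    show "inj_on (\<lambda>c. {src c, dst c}) {..<m}"
    proof (rule inj_onI)
      fix c c' assume *: "c \<in> {..<m}" "c' \<in> {..<m}" "{src c, dst c} = {src c', dst c'}"
      then have "src c = src c'" "dst c = dst c'"
        using els_nth(1)[of c] els_nth(1)[of c'] by (auto simp: doubleton_eq_iff)
      then show "c = c'" using * els_nth_eq by blast
    qed
    show "(\<lambda>c. {src c, dst c}) ` {..<m} = E2"
    proof
      show "(\<lambda>c. {src c, dst c}) ` {..<m} \<subseteq> E2"
        unfolding E2_def using nth_mem by (metis (mono_tags, lifting) image_subsetI lessThan_iff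
            mem_Collect_eq prod.collapse)
      show "E2 \<subseteq> (\<lambda>c. {src c, dst c}) ` {..<m}"
        unfolding E2_def by (auto simp: in_set_conv_nth image_iff) (metis fst_conv snd_conv lessThan_iff)
    qed
  qed

lemma sum_E2: "(\<Sum>e\<in>E2. f e) = (\<Sum>c<m. f {src c, dst c})"
  using sum.reindex_bij_betw[OF bij_E2, of f] by simp

lemma E2_ball: "(\<forall>e\<in>E2. P e) \<longleftrightarrow> (\<forall>c<m. P {src c, dst c})"
proof -
  have "E2 = (\<lambda>c. {src c, dst c}) ` {..<m}"
    using bij_E2 by (simp add: bij_betw_def)
  then show ?thesis by auto
qed

lemma simple_E2: "simple_graph ({..<h}, E2)"
  using els_less unfolding simple_graph_def E2_def
  by (auto simp: card_insert_if) (meson less_trans less_irrefl)+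

lemma bij_des: "bij_betw img {c. c < m \<and> des c} E1"
  unfolding bij_betw_def
proof
  show "inj_on img {c. c < m \<and> des c}"
    unfolding inj_on_def des_def by (auto; metis linorder_neqE_nat)
  have "e \<in> img ` {c. c < m \<and> des c}" if e: "e \<in> E1" for e
  proof -
    obtain u v where uv: "(u, v) \<in> set els" "e = {\<phi> u, \<phi> v}" using E1_sub[OF e] by blast
    then obtain c where c: "c < m" "els ! c = (u, v)" by (auto simp: in_set_conv_nth)
    then have "img c = e" using uv by (simp add: img_def)
    define c0 where "c0 = (LEAST c. img c = e)"
    have "img c0 = e" unfolding c0_def using \<open>img c = e\<close> by (rule LeastI)
    moreover have "c0 \<le> c" unfolding c0_def using \<open>img c = e\<close> by (rule Least_le)
    moreover have "\<forall>c'<c0. img c' \<noteq> e" unfolding c0_def using not_less_Least by blast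
    ultimately show ?thesis using c(1) e unfolding des_def by force
  qed
  then show "img ` {c. c < m \<and> des c} = E1" by (auto simp: des_def)
qed

lemma sum_des: "(\<Sum>c<m. if des c then f (img c) else 0) = (\<Sum>e\<in>E1. f e)"
proof -
  have "(\<Sum>c<m. if des c then f (img c) else 0) = (\<Sum>c\<in>{c. c < m \<and> des c}. f (img c))"
    by (rule sum.mono_neutral_cong_right) auto
  then show ?thesis using sum.reindex_bij_betw[OF bij_des, of f] by simp
qed

text \<open>The list of edges is distinct, so at most one class joins two given layers, and the
  quantifier and the sum collapse to it.\<close>

lemma flag_Wt:
  assumes "c < m" "x < n" "y < n"
  shows "flag n E D z (src c * n + x) (dst c * n + y) \<longleftrightarrow> ok E D z c x y"
    and "Wt n w (src c * n + x) (dst c * n + y) = wt n w c x y"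
proof -
  have dm: "(src c * n + x) div n = src c" "(src c * n + x) mod n = x"
    "(dst c * n + y) div n = dst c" "(dst c * n + y) mod n = y" using assms by auto
  have iff: "c' < m \<Longrightarrow> (src c' = src c \<and> dst c' = dst c) = (c' = c)" for c'
    using els_nth_eq[of c' c] assms(1) by auto
  show "flag n E D z (src c * n + x) (dst c * n + y) \<longleftrightarrow> ok E D z c x y"
    unfolding flag_def dm using iff assms(1) by auto
  have "Wt n w (src c * n + x) (dst c * n + y) = (\<Sum>c'<m. if c' = c then wt n w c' x y else 0)"
    unfolding Wt_def dm using iff by (intro sum.cong) auto
  then show "Wt n w (src c * n + x) (dst c * n + y) = wt n w c x y" using assms(1) by simp
qed

lemma neww_pair: "p < q \<Longrightarrow> neww n w {p, q} = Wt n w p q"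
  by (simp add: neww_def)

lemma (in -) block_less: "u < v \<Longrightarrow> x < n \<Longrightarrow> u * n + x < v * n + (y::nat)"
proof -
  assume "u < v" "x < n"
  then have "u * n + x < (u + 1) * n" "(u + 1) * n \<le> v * n" by (simp, intro mult_right_mono) auto
  then show ?thesis by linarith
qed

lemma simple_newE: "simple_graph ({..<(h + 1) * n}, newE n E D z)"
  unfolding simple_graph_def newE_def by (auto simp: card_insert_if)

section \<open>Digit sums and correctness of the reduction\<close>

lemma dig_simps:
  "i < m \<Longrightarrow> dig w i c x y = of_bool (c = i)"
  "l < m \<Longrightarrow> dig w (m + l) c x y = inc False l c x y"
  "l < m \<Longrightarrow> dig w (2 * m + l) c x y = inc True l c x y"
  "dig w (3 * m) c x y = (if des c then w {x, y} else 0)"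
  by (auto simp: dig_def)

lemma sum_inc:
  assumes "l < m" "ref (\<phi> (node s l)) = (s', l')"
  shows "(\<Sum>c<m. inc s l c (x c) (y c)) = int (val s (x l) (y l)) - int (val s' (x l') (y l'))"
proof -
  have "l' < m" using ref(1)[OF assms(1) refl, of s] assms(2) by simp
  then show ?thesis using assms by (simp add: inc_def sum_subtractf)
qed

text \<open>When the ends are chosen through a map g on the nodes of H1, an incidence and its
  reference show the same value and cancel; the top digit collects each edge of H1 once through its
  designated class.\<close>

lemma sum_dig:
  assumes "i \<le> 3 * m"
  shows "(\<Sum>c<m. dig w i c (g (\<phi> (src c))) (g (\<phi> (dst c)))) =
     tdig (\<Sum>e\<in>E1. w (g ` e)) i"
proof -
  have val: "val s (g (\<phi> (src c))) (g (\<phi> (dst c))) = g (\<phi> (node s c))" for s c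
    by (simp add: val_def node_def)
  have inc: "(\<Sum>c<m. inc s l c (g (\<phi> (src c))) (g (\<phi> (dst c)))) = 0" if "l < m" for s l
    using sum_inc[OF that prod.collapse[symmetric]] ref(2)[OF that refl, of s] by (simp add: val)
  consider "i < m" | l where "l < m" "i = m + l" | l where "l < m" "i = 2 * m + l" | "i = 3 * m"
  proof -
    assume thesis_cases: "i < m \<Longrightarrow> thesis" "\<And>l. l < m \<Longrightarrow> i = m + l \<Longrightarrow> thesis"
      "\<And>l. l < m \<Longrightarrow> i = 2 * m + l \<Longrightarrow> thesis" "i = 3 * m \<Longrightarrow> thesis"
    show thesis
      using thesis_cases(1,4) thesis_cases(2)[of "i - m"] thesis_cases(3)[of "i - 2 * m"] assms
      by linarith
  qed
  then show ?thesis
  proof cases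
    case 4
    then show ?thesis
      using sum_des[of "\<lambda>e. w (g ` e)"]
      by (simp add: dig_simps tdig_def) (simp only: img_def image_insert image_empty)
  qed (simp_all add: dig_simps tdig_def inc)
qed

lemma completeness:
  assumes ex: "exact_weight ({..<k}, E1) ({..<n}, E) w t" and n: "n \<le> 2 ^ L" and D: "2 * L + 2 \<le> D"
  shows "k \<le> n" and "\<exists>z. 1 \<le> z \<and> z < D ^ Suc (k * k) \<and>
    exact_weight ({..<h}, E2) ({..<(h + 1) * n}, newE n E D z) (neww n w) (tgt n t)"
proof -
  obtain g where g: "inj_on g {..<k}" "g ` {..<k} \<subseteq> {..<n}" "\<forall>e\<in>E1. g ` e \<in> E"
    "(\<Sum>e\<in>E1. w (g ` e)) = t"
    using ex unfolding exact_weight_iff[OF simple_E1] fst_conv snd_conv by blast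
  show "k \<le> n" using card_inj_on_le[OF g(1,2)] by simp
  \<comment> \<open>The additional digit at k * k is 1 and makes z positive, since stamp 0 marks
    unwritten memory. The summand 2 in the bound for D makes 1 a legal digit even for L = 0.\<close>
  define dd where "dd l = (if l = k * k then 1 else
      SOME d. d < 2 * L \<and> bitf d (g (l div k)) = 0 \<and> bitf d (g (l mod k)) = 1)" for l
  have dd: "dd (i * k + j) < 2 * L \<and> bitf (dd (i * k + j)) (g i) = 0 \<and>
      bitf (dd (i * k + j)) (g j) = 1" if "i < j" "j < k" for i j
  proof -
    have "i * k + j < k * k" using block_less[of i k j k 0] that by simp
    moreover have "(i * k + j) div k = i" "(i * k + j) mod k = j" using that by auto
    moreover have "g i \<noteq> g j" using g(1) that by (auto simp: inj_on_def)
    moreover have "g i < 2 ^ L" "g j < 2 ^ L"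
      using g(2) that less_le_trans[OF _ n] by (auto simp: image_subset_iff)
    ultimately show ?thesis
      unfolding dd_def using someI_ex[OF ex_bitf[of "g i" "g j" L]] by simp
  qed
  \<comment> \<open>On the diagonal no separating bit exists and the choice is arbitrary, so illegal
    digits are replaced by 0.\<close>
  define dd' where "dd' l = (if dd l < D then dd l else 0)" for l
  have "D > 0" using D by simp
  then have "\<exists>z<D ^ Suc (k * k). \<forall>l<Suc (k * k). z div D ^ l mod D = dd' l"
    by (intro ex_digits) (simp add: dd'_def)
  then obtain z where z: "z < D ^ Suc (k * k)" "\<forall>l<Suc (k * k). z div D ^ l mod D = dd' l" by blast
  have "z div D ^ (k * k) mod D = 1" using z(2) D by (simp add: dd'_def dd_def)
  then have z1: "1 \<le> z" by (cases "z = 0") auto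
  have dd_lt: "z div D ^ (i * k + j) mod D = dd (i * k + j)" if "i < j" "j < k" for i j
  proof -
    have "i * k + j < k * k" using block_less[of i k j k 0] that by simp
    then show ?thesis using z(2) dd[OF that] D by (simp add: dd'_def)
  qed
  have col: "col D z i (g i)" if "i < k" for i
    unfolding col_def using dd_lt dd that by simp
  have gn: "u < h \<Longrightarrow> g (\<phi> u) < n" and \<phi>k: "u < h \<Longrightarrow> \<phi> u < k" for u
    using g(2) \<phi>_surj by auto
  \<comment> \<open>The layer u keeps F injective although \<phi> is not.\<close>
  define F where "F u = u * n + g (\<phi> u)" for u
  have F_div: "F u div n = u" if "u < h" for u using gn[OF that] by (simp add: F_def)
  have F: "F ` {src c, dst c} = {src c * n + g (\<phi> (src c)), dst c * n + g (\<phi> (dst c))}" for c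
    by (simp add: F_def)
  have less: "src c * n + g (\<phi> (src c)) < dst c * n + g (\<phi> (dst c))"
      "src c < h" "dst c < h" if "c < m" for c
    using block_less[OF els_nth(1)[OF that]] gn els_nth[OF that] by auto
  have Fh: "F u < (h + 1) * n" if "u < h" for u
    using block_less[of u h "g (\<phi> u)" n n] gn[OF that] that by (simp add: F_def add.commute)
  have "(\<Sum>e\<in>E2. neww n w (F ` e)) = (\<Sum>c<m. wt n w c (g (\<phi> (src c))) (g (\<phi> (dst c))))"
    unfolding sum_E2 F using less gn by (intro sum.cong) (simp_all add: neww_pair flag_Wt)
  also have "\<dots> = (\<Sum>i<Suc (3 * m). (\<Sum>c<m. dig w i c (g (\<phi> (src c))) (g (\<phi> (dst c)))) * base n ^ i)"
    unfolding wt_def sum_distrib_right by (rule sum.swap)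
  also have "\<dots> = tgt n t"
    unfolding tgt_def using sum_dig[of _ w g] g(4) by (intro sum.cong) auto
  finally have sum: "(\<Sum>e\<in>E2. neww n w (F ` e)) = tgt n t" .
  have "\<forall>e\<in>E2. F ` e \<in> newE n E D z"
    unfolding E2_ball
  proof (intro allI impI)
    fix c assume c: "c < m"
    have "ok E D z c (g (\<phi> (src c))) (g (\<phi> (dst c)))"
      using col \<phi>k less[OF c] g(3) by (auto simp: ok_def des_def img_def)
    then show "F ` {src c, dst c} \<in> newE n E D z"
      unfolding F newE_def
      using less(1)[OF c] Fh[OF less(3)[OF c]]
        flag_Wt(1)[OF c gn[OF less(2)[OF c]] gn[OF less(3)[OF c]], of E D z]
      by (intro CollectI exI[of _ "F (src c)"] exI[of _ "F (dst c)"] conjI) (auto simp only: F_def)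
  qed
  moreover have "inj_on F {..<h}" by (metis F_div inj_onI lessThan_iff)
  ultimately have "exact_weight ({..<h}, E2) ({..<(h + 1) * n}, newE n E D z) (neww n w) (tgt n t)"
    unfolding exact_weight_iff[OF simple_E2] fst_conv snd_conv using sum Fh by blast
  then show "\<exists>z. 1 \<le> z \<and> z < D ^ Suc (k * k) \<and>
    exact_weight ({..<h}, E2) ({..<(h + 1) * n}, newE n E D z) (neww n w) (tgt n t)"
    using z1 z(1) by blast
qed

text \<open>The copy sends edge c of H2 to an edge of some class \<open>cl c\<close>, not
  necessarily c. Comparing digits shows first that \<open>cl\<close> is a permutation, then that the
  ends agree over each node of H1, and finally that the weight is right; the colours make the values
  over different nodes distinct.\<close>

lemma soundness:
  assumes ex: "exact_weight ({..<h}, E2) ({..<(h + 1) * n}, newE n E D z) (neww n w) (tgt n t)"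
    and kn: "k \<le> n"
  shows "exact_weight ({..<k}, E1) ({..<n}, E) w t"
proof -
  obtain G where G: "\<forall>e\<in>E2. G ` e \<in> newE n E D z" "(\<Sum>e\<in>E2. neww n w (G ` e)) = tgt n t"
    using ex unfolding exact_weight_iff[OF simple_E2] fst_conv snd_conv by blast
  have "\<exists>c' x y. c' < m \<and> x < n \<and> y < n \<and> ok E D z c' x y \<and>
      neww n w (G ` {src c, dst c}) = wt n w c' x y" if "c < m" for c
  proof -
    have "G ` {src c, dst c} \<in> newE n E D z" using G(1) that unfolding E2_ball by blast
    then obtain p q where pq: "G ` {src c, dst c} = {p, q}" "p < q" "q < (h + 1) * n" "flag n E D z p q"
      unfolding newE_def by blast
    then obtain c' where c': "c' < m" "src c' = p div n" "dst c' = q div n" "ok E D z c' (p mod n) (q mod n)"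
      unfolding flag_def by blast
    have n: "n > 0" using pq(3) by (cases n) auto
    have "neww n w {p, q} = Wt n w (src c' * n + p mod n) (dst c' * n + q mod n)"
      using pq(2) c' by (simp add: neww_pair)
    then show ?thesis using flag_Wt(2)[OF c'(1)] c' n pq(1) by (metis mod_less_divisor)
  qed
  then obtain cl X Y where cl: "\<And>c. c < m \<Longrightarrow> cl c < m \<and> X c < n \<and> Y c < n \<and> ok E D z (cl c) (X c) (Y c) \<and>
      neww n w (G ` {src c, dst c}) = wt n w (cl c) (X c) (Y c)"
    by metis
  have "(\<Sum>c<m. wt n w (cl c) (X c) (Y c)) = tgt n t"
    using G(2) cl unfolding sum_E2 by simp
  then have "(\<Sum>i<Suc (3 * m). (\<Sum>c<m. dig w i (cl c) (X c) (Y c)) * base n ^ i) =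
      (\<Sum>i<Suc (3 * m). tdig t i * base n ^ i)"
    unfolding wt_def tgt_def sum_distrib_right
    using sum.swap[of "\<lambda>c i. dig w i (cl c) (X c) (Y c) * base n ^ i" "{..<Suc (3 * m)}" "{..<m}"]
    by simp
  then have zero: "(\<Sum>i<Suc (3 * m). ((\<Sum>c<m. dig w i (cl c) (X c) (Y c)) - tdig t i) * base n ^ i) = 0"
    by (simp only: left_diff_distrib sum_subtractf diff_self)
  have bound: "\<bar>(\<Sum>c<m. dig w i (cl c) (X c) (Y c)) - tdig t i\<bar> < base n" if i: "i < 3 * m" for i
  proof -
    have inc_le: "\<bar>inc s l (cl c) (X c) (Y c)\<bar> \<le> int n" if "c < m" for s l c
      using cl[OF that] by (auto simp: inc_def val_def)
    have "\<bar>\<Sum>c<m. dig w i (cl c) (X c) (Y c)\<bar> \<le> (\<Sum>c<m. int n + 1)"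
    proof (rule order_trans[OF sum_abs], rule sum_mono)
      fix c assume c: "c \<in> {..<m}"
      then show "\<bar>dig w i (cl c) (X c) (Y c)\<bar> \<le> int n + 1"
        using i inc_le[of c False "i - m"] inc_le[of c True "i - 2 * m"] by (auto simp: dig_def)
    qed
    also have "\<dots> = base n - (int n + 1)" by (simp add: base_def algebra_simps)
    finally have *: "\<bar>\<Sum>c<m. dig w i (cl c) (X c) (Y c)\<bar> \<le> base n - (int n + 1)" .
    show ?thesis
    proof (cases "i < m")
      case True
      \<comment> \<open>Needed because m (n + 1) + 1 < (m + 1) (n + 1) fails for n = 0; an edge of
        the copy provides a node.\<close>
      have "n > 0" using cl[of i] True by linarith
      then show ?thesis using * True by (simp add: tdig_def)
    next
      case False
      then show ?thesis using * i by (simp add: tdig_def)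
    qed
  qed
  have dig_cl: "(\<Sum>c<m. dig w i (cl c) (X c) (Y c)) = tdig t i" if "i \<le> 3 * m" for i
    using sum_powers_zero[OF zero bound that] by simp
  \<comment> \<open>An omitted class would give 0 at its indicator digit, where the target has 1. So
    \<open>cl\<close> is onto and, on a finite set, bijective.\<close>
  have "l \<in> cl ` {..<m}" if "l < m" for l
  proof (rule ccontr)
    assume "l \<notin> cl ` {..<m}"
    then have "(\<Sum>c<m. dig w l (cl c) (X c) (Y c)) = 0"
      using that by (intro sum.neutral) (auto simp: dig_def)
    then show False using dig_cl[of l] that by (simp add: tdig_def)
  qed
  moreover have "cl ` {..<m} \<subseteq> {..<m}" using cl by auto
  ultimately have "cl ` {..<m} = {..<m}" by auto
  then have bij: "bij_betw cl {..<m} {..<m}"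
    using finite_surj_inj[of "{..<m}" cl] by (auto simp: bij_betw_def)
  define r where "r = inv_into {..<m} cl"
  have r: "r l < m" "cl (r l) = l" if "l < m" for l
    using bij that unfolding r_def by (metis bij_betw_def f_inv_into_f inv_into_into lessThan_iff)+
  have r_cl: "r (cl c) = c" if "c < m" for c
    using bij that unfolding r_def by (simp add: bij_betw_inv_into_left)
  define x y where "x l = X (r l)" and "y l = Y (r l)" for l
  have xy: "x l < n" "y l < n" "ok E D z l (x l) (y l)" if "l < m" for l
    using cl[OF r(1)[OF that]] r(2)[OF that] by (auto simp: x_def y_def)
  \<comment> \<open>Reindexing by the permutation: from here on class l has the ends
    \<open>x l\<close> and \<open>y l\<close>, and it no longer matters which edge of H2 produced
    them.\<close>
  have dig: "(\<Sum>l<m. dig w i l (x l) (y l)) = tdig t i" if "i \<le> 3 * m" for i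
    using sum.reindex_bij_betw[OF bij, of "\<lambda>l. dig w i l (x l) (y l)"] dig_cl[OF that]
    by (simp add: x_def y_def r_cl)
  define g0 where "g0 i = val (fst (ref i)) (x (snd (ref i))) (y (snd (ref i)))" for i
  \<comment> \<open>The vanishing digits from m to 3 m - 1 say that each incidence agrees with the
    reference incidence over the same node of H1.\<close>
  have val: "val s (x l) (y l) = g0 (\<phi> (node s l))" if l: "l < m" for s l
  proof -
    have "(\<Sum>c<m. inc s l c (x c) (y c)) = 0"
    proof (cases s)
      case True
      then show ?thesis using dig[of "2 * m + l"] l by (simp add: dig_simps tdig_def)
    next
      case False
      then show ?thesis using dig[of "m + l"] l by (simp add: dig_simps tdig_def)
    qed
    then show ?thesis using sum_inc[OF l prod.collapse[symmetric]] by (simp add: g0_def)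
  qed
  have x: "x l = g0 (\<phi> (src l))" and y: "y l = g0 (\<phi> (dst l))" if "l < m" for l
    using val[OF that, of False] val[OF that, of True] by (auto simp: val_def node_def)
  define I where "I = {\<phi> (node s l) | s l. l < m}"
  have I: "i < k" "g0 i < n" "col D z i (g0 i)" if i: "i \<in> I" for i
  proof -
    obtain s l where l: "l < m" "i = \<phi> (node s l)" using i unfolding I_def by blast
    then show "i < k" using \<phi>_node by simp
    show "g0 i < n" "col D z i (g0 i)"
      using xy[OF l(1)] x[OF l(1)] y[OF l(1)] l(2) unfolding ok_def node_def by (auto split: if_splits)
  qed
  have "g0 i \<noteq> g0 j" if "i \<in> I" "j \<in> I" "i < j" for i j
  proof -
    have "bitf (z div D ^ (i * k + j) mod D) (g0 i) = 0" "bitf (z div D ^ (i * k + j) mod D) (g0 j) = 1"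
      using I(1,3)[OF that(1)] I(1,3)[OF that(2)] that(3) unfolding col_def by auto
    then show ?thesis by auto
  qed
  then have "inj_on g0 I" by (metis inj_onI linorder_neqE_nat)
  moreover have "I \<subseteq> {..<k}" "g0 ` I \<subseteq> {..<n}" using I(1,2) by auto
  ultimately obtain g where g: "inj_on g {..<k}" "g ` {..<k} \<subseteq> {..<n}" "\<forall>i\<in>I. g i = g0 i"
    using ex_inj_extension[of g0 I k n] kn by blast
  have g_img: "g ` img c = {x c, y c}" if "c < m" for c
  proof -
    have "\<phi> (src c) \<in> I" "\<phi> (dst c) \<in> I" using that unfolding I_def node_def by force+
    then show ?thesis using g(3) x[OF that] y[OF that] by (simp add: img_def)
  qed
  have "\<forall>e\<in>E1. g ` e \<in> E"
  proof
    fix e assume "e \<in> E1"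
    then obtain c where "c < m" "des c" "e = img c" using bij_des unfolding bij_betw_def by blast
    then show "g ` e \<in> E" using g_img xy(3) unfolding ok_def by simp
  qed
  moreover have "(\<Sum>c<m. if des c then w (g ` img c) else 0) = (\<Sum>c<m. dig w (3 * m) c (x c) (y c))"
    using g_img by (intro sum.cong) (simp_all add: dig_simps)
  then have "(\<Sum>e\<in>E1. w (g ` e)) = t"
    using dig[of "3 * m"] sum_des[of "\<lambda>e. w (g ` e)"] by (simp add: tdig_def)
  ultimately show ?thesis
    unfolding exact_weight_iff[OF simple_E1] fst_conv snd_conv using g by blast
qed

end

section \<open>Evaluating the reduced instance\<close>

abbreviation add_e :: "expr \<Rightarrow> expr \<Rightarrow> expr" (infixl "\<oplus>" 65) where "x \<oplus> y \<equiv> Bin Add x y"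
abbreviation sub_e :: "expr \<Rightarrow> expr \<Rightarrow> expr" (infixl "\<ominus>" 65) where "x \<ominus> y \<equiv> Bin Sub x y"
abbreviation mul_e :: "expr \<Rightarrow> expr \<Rightarrow> expr" (infixl "\<otimes>" 70) where "x \<otimes> y \<equiv> Bin Mul x y"
abbreviation div_e :: "expr \<Rightarrow> expr \<Rightarrow> expr" (infixl "\<oslash>" 70) where "x \<oslash> y \<equiv> Bin Div x y"
abbreviation mod_e :: "expr \<Rightarrow> expr \<Rightarrow> expr" (infixl "\<odot>" 70) where "x \<odot> y \<equiv> Bin Mod x y"

primrec pow_e :: "expr \<Rightarrow> nat \<Rightarrow> expr" where
  "pow_e e 0 = Num 1"
| "pow_e e (Suc l) = e \<otimes> pow_e e l"

primrec conj_e :: "expr list \<Rightarrow> expr" where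
  "conj_e [] = Num 1"
| "conj_e (c # cs) = Ite c (conj_e cs) (Num 0)"

primrec sum_e :: "expr list \<Rightarrow> expr" where
  "sum_e [] = Num 0"
| "sum_e (e # es) = e \<oplus> sum_e es"

primrec horner_e :: "expr \<Rightarrow> expr list \<Rightarrow> expr" where
  "horner_e b [] = Num 0"
| "horner_e b (e # es) = e \<oplus> b \<otimes> horner_e b es"

lemma eval_pow_e [simp]: "eval s (pow_e e l) = eval s e ^ l"
  by (induction l) auto

lemma eval_conj_e [simp]: "eval s (conj_e cs) = of_bool (\<forall>c\<in>set cs. eval s c > 0)"
  by (induction cs) auto

lemma eval_sum_e [simp]: "eval s (sum_e es) = (\<Sum>e\<leftarrow>es. eval s e)"
  by (induction es) auto

lemma eval_horner_e: "eval s (horner_e b es) = (\<Sum>i<length es. eval s (es ! i) * eval s b ^ i)"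
proof (induction es)
  case (Cons e es)
  show ?case
    by (simp add: Cons.IH sum.lessThan_Suc_shift sum_distrib_left mult_ac del: sum.lessThan_Suc)
qed simp

lemma wf_pow_e [simp]: "wf_expr T e \<Longrightarrow> wf_expr T (pow_e e l)"
  by (induction l) auto

lemma wf_conj_e [simp]: "wf_expr T (conj_e cs) \<longleftrightarrow> (\<forall>c\<in>set cs. wf_expr T c)"
  by (induction cs) auto

lemma wf_sum_e [simp]: "wf_expr T (sum_e es) \<longleftrightarrow> (\<forall>e\<in>set es. wf_expr T e)"
  by (induction es) auto

lemma wf_horner_e [simp]: "wf_expr T b \<Longrightarrow> wf_expr T (horner_e b es) \<longleftrightarrow> (\<forall>e\<in>set es. wf_expr T e)"
  by (induction es) auto

text \<open>A right shift divides by a power with variable exponent in a single instruction.\<close>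

definition bitf_e :: "expr \<Rightarrow> expr \<Rightarrow> expr" where
  "bitf_e d x = (Bin Shr x (d \<oslash> Num 2) \<oplus> d) \<odot> Num 2"

lemma eval_bitf_e:
  assumes "eval s d = int d'" "eval s x = int x'"
  shows "eval s (bitf_e d x) = int (bitf d' x')"
  using assms
  by (simp add: bitf_e_def bitf_def drop_bit_eq_div zmod_int zdiv_int nat_div_distrib)

lemma wf_bitf_e [simp]: "wf_expr T d \<Longrightarrow> wf_expr T x \<Longrightarrow> wf_expr T (bitf_e d x)"
  by (simp add: bitf_e_def)

lemma input_mem_cell:
  assumes "x < n" "y < n"
  shows "input_mem n E w (2 * (int x * int n + int y)) = of_bool ({x, y} \<in> E)"
    and "input_mem n E w (2 * (int x * int n + int y) + 1) = (if {x, y} \<in> E then w {x, y} else 0)"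
proof -
  have less: "x * n + y < n * n" using block_less[of x n y n 0] assms by simp
  have q: "nat (2 * (int x * int n + int y)) = 2 * (x * n + y)"
    "nat (2 * (int x * int n + int y) + 1) = 2 * (x * n + y) + 1"
    by (simp_all add: nat_eq_iff)
  have dm: "(x * n + y) div n = x" "(x * n + y) mod n = y" using assms by auto
  have ge: "\<not> 2 * (int x * int n + int y) < 0" "\<not> 2 * (int x * int n + int y) + 1 < 0"
    by (simp_all add: not_less add_nonneg_nonneg)
  show "input_mem n E w (2 * (int x * int n + int y)) = of_bool ({x, y} \<in> E)"
    unfolding input_mem_def q Let_def using ge(1) less dm by simp
  show "input_mem n E w (2 * (int x * int n + int y) + 1) = (if {x, y} \<in> E then w {x, y} else 0)"
    unfolding input_mem_def q Let_def using ge(2) less dm by simp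
qed

section \<open>The reduced input as an expression\<close>

context reduction
begin

text \<open>
  The registers R, ..., R + 3 hold n, the target, the bit length of n and the index z of the instance;
  R + 4 is the answer and R + 5 the address register.
\<close>
context
  fixes R :: nat
begin

abbreviation "n_e \<equiv> Var R"
abbreviation "t_e \<equiv> Var (R + 1)"
abbreviation "L_e \<equiv> Var (R + 2)"
abbreviation "z_e \<equiv> Var (R + 3)"
abbreviation "a_e \<equiv> Var (R + 5)"

definition "D_e = Num 2 \<otimes> L_e \<oplus> Num 2"
definition "digit_e l = (z_e \<oslash> pow_e D_e l) \<odot> D_e"

definition "col_e i x = conj_e (map (\<lambda>j.
   if i < j then Num 1 \<ominus> bitf_e (digit_e (i * k + j)) x
   else if j < i then bitf_e (digit_e (j * k + i)) x else Num 1) [0..<k])"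

definition "cell_e x y = Num 2 \<otimes> (x \<otimes> n_e \<oplus> y)"

definition "ok_e c x y = conj_e [col_e (\<phi> (src c)) x, col_e (\<phi> (dst c)) y,
   if des c then Cell (cell_e x y) else Num 1]"

definition "inc_e s l c x y = (if c = l then val s x y else Num 0) \<ominus>
   (if c = snd (ref (\<phi> (node s l))) then val (fst (ref (\<phi> (node s l)))) x y else Num 0)"

definition "dig_e i c x y =
   (if i < m then Num (of_bool (c = i)) else if i < 2 * m then inc_e False (i - m) c x y
    else if i < 3 * m then inc_e True (i - 2 * m) c x y
    else if des c then Cell (cell_e x y \<oplus> Num 1) else Num 0)"

definition "base_e = Num (int (m + 1)) \<otimes> (n_e \<oplus> Num 1)"
definition "wt_e c x y = horner_e base_e (map (\<lambda>i. dig_e i c x y) [0..<Suc (3 * m)])"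
definition "tgt_e = horner_e base_e
   (map (\<lambda>i. if i < m then Num 1 else if i < 3 * m then Num 0 else t_e) [0..<Suc (3 * m)])"
definition "match_e c p q =
   conj_e [eq_e (p \<oslash> n_e) (Num (int (src c))), eq_e (q \<oslash> n_e) (Num (int (dst c)))]"
definition "flag_e p q =
   sum_e (map (\<lambda>c. Ite (match_e c p q) (ok_e c (p \<odot> n_e) (q \<odot> n_e)) (Num 0)) [0..<m])"
definition "Wt_e p q =
   sum_e (map (\<lambda>c. Ite (match_e c p q) (wt_e c (p \<odot> n_e) (q \<odot> n_e)) (Num 0)) [0..<m])"
definition "size_e = Num (int (h + 1)) \<otimes> n_e"
definition "pair_e p q = Ite (flag_e p q) (Ite (a_e \<odot> Num 2) (Wt_e p q) (Num 1)) (Num 0)"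
definition "row_e = (a_e \<oslash> Num 2) \<oslash> size_e"
definition "column_e = (a_e \<oslash> Num 2) \<odot> size_e"
text \<open>The matrix is symmetric whereas flags and weights are defined for p < q, so row and
  column are swapped when necessary. For n = 0 the divisions by 0 are harmless: the guard on the
  size gives 0 everywhere.\<close>

definition "virtual_e =
   Ite (Num 0 \<ominus> a_e) (Num 0)
     (Ite (size_e \<otimes> size_e \<ominus> a_e \<oslash> Num 2)
       (Ite (column_e \<ominus> row_e) (pair_e row_e column_e)
         (Ite (row_e \<ominus> column_e) (pair_e column_e row_e) (Num 0)))
       (Num 0))"

lemma wf_digit_e [simp]: "wf_expr (R + 6) (digit_e l)"
  by (simp add: digit_e_def D_e_def)

lemma wf_ok_e [simp]: "wf_expr (R + 6) x \<Longrightarrow> wf_expr (R + 6) y \<Longrightarrow> wf_expr (R + 6) (ok_e c x y)"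
  by (auto simp: ok_e_def col_e_def cell_e_def)

lemma wf_base_e [simp]: "wf_expr (R + 6) base_e"
  by (simp add: base_e_def)

lemma wf_wt_e [simp]: "wf_expr (R + 6) x \<Longrightarrow> wf_expr (R + 6) y \<Longrightarrow> wf_expr (R + 6) (wt_e c x y)"
  by (auto simp: wt_e_def dig_e_def inc_e_def val_def cell_e_def)

lemma wf_tgt_e [simp]: "wf_expr (R + 6) tgt_e"
  by (auto simp: tgt_e_def)

lemma wf_size_e [simp]: "wf_expr (R + 6) size_e"
  by (simp add: size_e_def)

lemma wf_pair_e [simp]: "wf_expr (R + 6) p \<Longrightarrow> wf_expr (R + 6) q \<Longrightarrow> wf_expr (R + 6) (pair_e p q)"
  by (auto simp: pair_e_def flag_e_def Wt_e_def match_e_def)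

lemma wf_virtual_e [simp]: "wf_expr (R + 6) virtual_e"
  by (simp add: virtual_e_def row_e_def column_e_def)

definition own :: "nat \<Rightarrow> nat set set \<Rightarrow> (nat set \<Rightarrow> int) \<Rightarrow> int \<Rightarrow> nat \<Rightarrow> nat \<Rightarrow> state \<Rightarrow> bool" where
  "own n E w t L z s \<longleftrightarrow> fst s R = int n \<and> fst s (R + 1) = t \<and> fst s (R + 2) = int L \<and>
     fst s (R + 3) = int z \<and> (\<forall>c\<ge>0. snd s c = input_mem n E w c)"

context
  fixes n E w t L z s
  assumes own: "own n E w t L z s"
begin

lemma regs_own [simp]: "fst s R = int n" "fst s (Suc R) = t" "fst s (Suc (Suc R)) = int L" "fst s (R + 3) = int z"
  using own unfolding own_def by auto

lemma eval_D_e: "eval s D_e = int (2 * L + 2)"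
  by (simp add: D_e_def)

lemma eval_digit_e: "eval s (digit_e l) = int (z div (2 * L + 2) ^ l mod (2 * L + 2))"
  by (simp add: digit_e_def eval_D_e zmod_int zdiv_int)

lemma eval_col_e:
  assumes "eval s x = int x'"
  shows "eval s (col_e i x) = of_bool (col (2 * L + 2) z i x')"
proof -
  have b: "eval s (bitf_e (digit_e l) x) = int (bitf (z div (2 * L + 2) ^ l mod (2 * L + 2)) x')" for l
    using eval_bitf_e[OF eval_digit_e assms] .
  have lt: "bitf d x' < 2" for d by (simp add: bitf_def)
  have "(0 < 1 - int (bitf d x')) = (bitf d x' = 0)" "(0 < int (bitf d x')) = (bitf d x' = 1)" for d
    using lt[of d] by linarith+
  then have "eval s (if i < j then Num 1 \<ominus> bitf_e (digit_e (i * k + j)) x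
      else if j < i then bitf_e (digit_e (j * k + i)) x else Num 1) > 0 \<longleftrightarrow>
    (i < j \<longrightarrow> bitf (z div (2 * L + 2) ^ (i * k + j) mod (2 * L + 2)) x' = 0) \<and>
    (j < i \<longrightarrow> bitf (z div (2 * L + 2) ^ (j * k + i) mod (2 * L + 2)) x' = 1)" for j
    by (simp only: eval.simps binop_val.simps b if_distrib[of "eval s"] split: if_splits) auto
  then show ?thesis
    unfolding col_e_def col_def eval_conj_e set_map ball_simps(9) set_upt atLeast0LessThan
    by (simp add: Ball_def)
qed

lemma eval_cell:
  assumes "eval s x = int x'" "eval s y = int y'" "x' < n" "y' < n"
  shows "eval s (Cell (cell_e x y)) = of_bool ({x', y'} \<in> E)"
    and "eval s (Cell (cell_e x y \<oplus> Num 1)) = (if {x', y'} \<in> E then w {x', y'} else 0)"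
proof -
  have "0 \<le> 2 * (int x' * int n + int y')" by simp
  then show "eval s (Cell (cell_e x y)) = of_bool ({x', y'} \<in> E)"
    and "eval s (Cell (cell_e x y \<oplus> Num 1)) = (if {x', y'} \<in> E then w {x', y'} else 0)"
    using own input_mem_cell[OF assms(3,4), of E w] assms(1,2) unfolding own_def
    by (simp_all add: cell_e_def)
qed

lemma eval_ok_e:
  assumes "eval s x = int x'" "eval s y = int y'" "x' < n" "y' < n"
  shows "eval s (ok_e c x y) = of_bool (ok E (2 * L + 2) z c x' y')"
  using eval_cell(1)[OF assms] by (auto simp: ok_e_def ok_def eval_col_e[OF assms(1)] eval_col_e[OF assms(2)])

lemma eval_base_e: "eval s base_e = base n"
  by (simp add: base_e_def base_def)

lemma eval_wt_e:
  assumes "eval s x = int x'" "eval s y = int y'" "x' < n" "y' < n"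
  shows "eval s (wt_e c x y) = wt n (\<lambda>e. if e \<in> E then w e else 0) c x' y'"
proof -
  have inc: "eval s (inc_e b l c x y) = inc b l c x' y'" for b l
    using assms(1,2) by (simp add: inc_e_def inc_def val_def)
  have "eval s (dig_e i c x y) = dig (\<lambda>e. if e \<in> E then w e else 0) i c x' y'" for i
    using eval_cell(2)[OF assms] by (auto simp: dig_e_def dig_def inc)
  then show ?thesis
    unfolding wt_e_def wt_def eval_horner_e eval_base_e by (intro sum.cong) (auto simp del: upt_Suc)
qed

lemma eval_tgt_e: "eval s tgt_e = tgt n t"
  unfolding tgt_e_def tgt_def eval_horner_e eval_base_e
  by (intro sum.cong) (auto simp: tdig_def simp del: upt_Suc)

lemma eval_size_e: "eval s size_e = int ((h + 1) * n)"
  by (simp add: size_e_def algebra_simps)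

lemma eval_pair_e:
  assumes "eval s p = int p'" "eval s q = int q'" "0 < n"
  shows "eval s (pair_e p q) =
     (if flag n E (2 * L + 2) z p' q'
      then if fst s (R + 5) mod 2 > 0 then Wt n (\<lambda>e. if e \<in> E then w e else 0) p' q' else 1 else 0)"
proof -
  have m: "eval s (p \<odot> n_e) = int (p' mod n)" "eval s (q \<odot> n_e) = int (q' mod n)"
    using assms by (simp_all add: zmod_int)
  have "p' mod n < n" "q' mod n < n" using assms(3) by auto
  note ev = eval_ok_e[OF m this] eval_wt_e[OF m this]
  have match: "eval s (match_e c p q) = of_bool (src c = p' div n \<and> dst c = q' div n)" for c
    using assms(1,2) by (auto simp: match_e_def simp flip: zdiv_int)
  have "eval s (flag_e p q) =
      (\<Sum>c<m. of_bool (src c = p' div n \<and> dst c = q' div n \<and> ok E (2 * L + 2) z c (p' mod n) (q' mod n)))"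
    unfolding flag_e_def eval_sum_e map_map o_def interv_sum_list_conv_sum_set_nat set_upt atLeast0LessThan
    by (intro sum.cong) (auto simp: match ev)
  moreover have "((\<Sum>c<m. of_bool (src c = p' div n \<and> dst c = q' div n \<and>
      ok E (2 * L + 2) z c (p' mod n) (q' mod n))) > (0 :: int)) = flag n E (2 * L + 2) z p' q'"
    unfolding flag_def by (auto simp: sum_of_bool_eq card_gt_0_iff)
  ultimately have "(eval s (flag_e p q) > 0) = flag n E (2 * L + 2) z p' q'" by simp
  moreover have "eval s (Wt_e p q) = Wt n (\<lambda>e. if e \<in> E then w e else 0) p' q'"
    unfolding Wt_e_def Wt_def eval_sum_e map_map o_def interv_sum_list_conv_sum_set_nat set_upt atLeast0LessThan
    by (intro sum.cong) (auto simp: match ev)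
  ultimately show ?thesis by (simp add: pair_e_def)
qed

text \<open>This constant-cost expression replaces writing down a matrix for every instance. Weights
  are cut off to 0 outside E because that is what the input memory shows at non-edges.\<close>

lemma eval_virtual_e:
  "eval s virtual_e = input_mem ((h + 1) * n) (newE n E (2 * L + 2) z)
     (neww n (\<lambda>e. if e \<in> E then w e else 0)) (fst s (R + 5))"
proof -
  define N where "N = (h + 1) * n"
  define a where "a = fst s (R + 5)"
  define w' where "w' = (\<lambda>e. if e \<in> E then w e else 0)"
  have size: "eval s size_e = int N" using eval_size_e by (simp add: N_def)
  show ?thesis
  proof (cases "a < 0")
    case True
    then show ?thesis by (simp add: virtual_e_def input_mem_def a_def Let_def)
  next
    case False
    define q where "q = nat a div 2"
    have q: "a div 2 = int q" using False by (simp add: q_def zdiv_int)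
    define i j where "i = q div N" and "j = q mod N"
    have row: "eval s row_e = int i" and column: "eval s column_e = int j"
      using q by (simp_all add: row_e_def column_e_def size i_def j_def zdiv_int zmod_int flip: a_def)
    show ?thesis
    proof (cases "q < N * N")
      case q_less: True
      then have "N > 0" by (cases N) auto
      then have n: "n > 0" by (auto simp: N_def)
      have ij: "i < N" "j < N" using q_less \<open>N > 0\<close> by (auto simp: i_def j_def less_mult_imp_div_less)
      have mem: "input_mem N F v a = (if {i, j} \<in> F then if even a then 1 else v {i, j} else 0)" for F v
        using False q_less unfolding input_mem_def Let_def q_def[symmetric] i_def[symmetric] j_def[symmetric]
        by auto
      have ev: "eval s virtual_e = (if i < j then eval s (pair_e row_e column_e)
          else if j < i then eval s (pair_e column_e row_e) else 0)"
        using False q q_less by (simp add: virtual_e_def size row column flip: a_def of_nat_mult)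
      have par: "a mod 2 > 0 \<longleftrightarrow> odd a" by presburger
      have newE: "{u, v} \<in> newE n E (2 * L + 2) z \<longleftrightarrow> flag n E (2 * L + 2) z u v" if "u < v" "v < N" for u v
        using that unfolding newE_def N_def[symmetric] by (auto simp: doubleton_eq_iff)
      have eq: "(if flag n E (2 * L + 2) z u v then if a mod 2 > 0 then Wt n w' u v else 1 else 0) =
          (if {u, v} \<in> newE n E (2 * L + 2) z then if even a then 1 else neww n w' {u, v} else 0)"
        if "u < v" "v < N" for u v
        using par newE[OF that] neww_pair[OF that(1)] by auto
      have diag: "{i, i} \<notin> newE n E (2 * L + 2) z" unfolding newE_def by (auto simp: doubleton_eq_iff)
      show ?thesis
        unfolding N_def[symmetric] a_def[symmetric] w'_def[symmetric] mem ev
          eval_pair_e[OF row column n] eval_pair_e[OF column row n]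
        using eq[of i j] eq[of j i] ij diag
        by (cases i j rule: linorder_cases) (auto simp: insert_commute simp flip: a_def w'_def)
    next
      case q_ge: False
      have "eval s virtual_e = 0"
        using False q q_ge by (simp add: virtual_e_def size flip: a_def of_nat_mult)
      moreover have "input_mem N F v a = 0" for F v
        using q_ge unfolding input_mem_def Let_def q_def[symmetric] by simp
      ultimately show ?thesis by (simp add: N_def a_def)
    qed
  qed
qed

end

end

end

section \<open>Word size\<close>

lemma exact_weight_cong:
  fixes G :: "'a graph"
  assumes "\<And>e. e \<in> edges G \<Longrightarrow> w e = w' e"
  shows "exact_weight H G w t = exact_weight H G w' t"
proof -
  have "(\<Sum>e\<in>edges S. w e) = (\<Sum>e\<in>edges S. w' e)" if "subgraph_of S G" for S :: "'a graph"
    using that assms unfolding subgraph_of_def by (intro sum.cong) auto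
  then show ?thesis unfolding exact_weight_def by metis
qed

lemma exec_mono: "exec B P s k s' \<Longrightarrow> B \<le> B' \<Longrightarrow> exec B' P s k s'"
proof (induction rule: exec.induct)
  case (Instr i s s')
  then have "exec_instr B' i s s'"
    by (cases rule: exec_instr.cases) (auto intro: exec_instr.intros)
  then show ?case by (rule exec.Instr)
qed (blast intro: exec.intros)+

lemma abs_input_mem_le:
  assumes "finite E" "max_number E w t \<le> U" "1 \<le> U"
  shows "\<bar>input_mem n E w c\<bar> \<le> U"
proof -
  have "\<bar>w e\<bar> \<le> U" if "e \<in> E" for e
    using that assms(1,2) Max_ge[of "insert \<bar>t\<bar> ((\<lambda>e. \<bar>w e\<bar>) ` E)" "\<bar>w e\<bar>"]
    unfolding max_number_def by force
  then show ?thesis using assms(3) by (auto simp: input_mem_def Let_def)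
qed

lemma abs_target_le: "finite E \<Longrightarrow> \<bar>t\<bar> \<le> max_number E w t"
  by (simp add: max_number_def)

lemma finite_edges: "simple_graph (V, E) \<Longrightarrow> finite E"
  unfolding simple_graph_def by (auto intro: finite_subset[of E "Pow V"])

lemma floorlog_le: "floorlog 2 n \<le> n"
proof (cases "n = 0")
  case False
  then have "2 ^ (floorlog 2 n - 1) \<le> n" using floorlog_bounds[of n 2] by simp
  moreover have "floorlog 2 n - 1 < 2 ^ (floorlog 2 n - 1)" by simp
  ultimately show ?thesis by linarith
qed (simp add: floorlog_def)

lemma le_2_power_floorlog: "n \<le> 2 ^ floorlog 2 n"
  using floorlog_bounds[of n 2] by (cases "n = 0") auto

section \<open>The driver program and its exponents\<close>

context reduction
begin

definition init_e :: "nat \<Rightarrow> nat \<Rightarrow> expr" where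
  "init_e R r = (if r = 0 then size_e R else if r = 1 then tgt_e R else Num 0)"

text \<open>Simulated registers hold leftovers of the previous instance and are reset explicitly.
  The initial values are computed from registers from R on, so the resets do not disturb each
  other.\<close>

primrec init :: "nat \<Rightarrow> nat \<Rightarrow> prog" where
  "init R 0 = assign (R + 6) (R + 5) (Num 0)"
| "init R (Suc r) = Seq (init R r) (assign (R + 6) r (init_e R r))"

definition "answer_e R = Ite (Var 0) (Num 1) (Var (R + 4))"
text \<open>For n < k no instance is run: H1 has no copy in G, and \<open>soundness\<close> relies
  on k \<le> n.\<close>

definition "count_e R = Ite (Num (int k) \<ominus> n_e R) (Num 0) (pow_e (D_e R) (Suc (k * k)) \<ominus> Num 1)"

definition "body R P = Seq (init R R) (Seq (sim (R + 6) (R + 5) (R + 3) (virtual_e R) P)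
   (Seq (assign (R + 6) (R + 4) (answer_e R)) (assign (R + 6) (R + 3) (z_e R \<ominus> Num 1))))"

text \<open>Repeated halving counts the bits of n, there being no logarithm instruction; the
  register of z is borrowed for it.\<close>

definition "log_body R = Seq (assign (R + 6) (R + 2) (L_e R \<oplus> Num 1))
   (assign (R + 6) (R + 3) (z_e R \<oslash> Num 2))"

definition "main R P =
   Seq (assign (R + 6) R (Var 0)) (Seq (assign (R + 6) (R + 1) (Var 1))
     (Seq (assign (R + 6) (R + 3) (Var 0)) (Seq (WhilePos (R + 3) (log_body R))
       (Seq (assign (R + 6) (R + 3) (count_e R)) (Seq (WhilePos (R + 3) (body R P))
         (assign (R + 6) 0 (Var (R + 4))))))))"

text \<open>The exponents avoid circularity. \<open>address_exp\<close> covers z and the addresses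
  of the reduced matrix; \<open>number_exp\<close> then bounds all numbers of the reduced instance
  without mention of a program; its multiple by \<open>Suc d\<close> accounts for the words of the
  given program in \<open>reg_exp\<close>; and \<open>word_exp\<close> adds the intermediate values
  of all expressions evaluated.\<close>

definition "address_exp R = 2 + ebound 1 (count_e R) + 2 * ebound 1 (size_e R)"
definition "number_exp R = ebound 1 (size_e R) + ebound (address_exp R) (virtual_e R) + ebound 1 (tgt_e R) + 3"
definition "reg_exp R d = address_exp R + number_exp R * Suc d"
definition "all_exprs R = [Num 0, Num 1, Var 0, Var 1, Var (R + 4), size_e R, tgt_e R, answer_e R, count_e R,
   z_e R \<ominus> Num 1, L_e R \<oplus> Num 1, z_e R \<oslash> Num 2,
   load_e (R + 5) (R + 3) (virtual_e R), tag_e (R + 5)]"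
definition "word_exp R d = reg_exp R d + (\<Sum>e\<leftarrow>all_exprs R. ebound (reg_exp R d) e)"

lemma ebound_all_exprs: "e \<in> set (all_exprs R) \<Longrightarrow> ebound (reg_exp R d) e \<le> word_exp R d"
  unfolding word_exp_def by (intro trans_le_add2 member_le_sum_list) auto

definition "init_cost R = 2 + (\<Sum>r<R. cost (init_e R r) + 1)"
definition "body_cost R T = init_cost R + (simulation.slow (R + 5) (R + 3) (virtual_e R) * T +
   (cost (answer_e R) + 1 + 4))"

end

text \<open>With \<open>R \<ge> 2\<close> the driver's own registers are apart from the input
  registers 0 and 1, which can thus be copied first.\<close>

locale reduction_run = reduction +
  fixes R :: nat and P :: prog and d :: nat and Tf :: "nat \<Rightarrow> nat"
    and n :: nat and E :: "nat set set" and w :: "nat set \<Rightarrow> int" and t :: int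
  assumes R: "R \<ge> 2" and below: "prog_below R P"
    and solves: "solves_exact_weight ({..<h}, E2) P d Tf"
    and simple: "simple_graph ({..<n}, E)"
begin

definition "X = int n + max_number E w t + 2"
definition "L = floorlog 2 n"
definition "w0 = (\<lambda>e. if e \<in> E then w e else 0)"
definition "N = (h + 1) * n"
definition "E' z = newE n E (2 * L + 2) z"
definition "w' = neww n w0"
definition "t' = tgt n t"
definition "zmax = (if n < k then 0 else (2 * L + 2) ^ Suc (k * k) - 1)"
definition "yes z \<longleftrightarrow> exact_weight ({..<h}, E2) ({..<N}, E' z) w' t'"
definition "bounded_by a s \<longleftrightarrow> (\<forall>r<R + 6. \<bar>fst s r\<bar> \<le> X ^ a) \<and> (\<forall>c. \<bar>snd s c\<bar> \<le> X ^ a)"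

abbreviation "a \<equiv> reg_exp R d"
abbreviation "b \<equiv> word_exp R d"
abbreviation "own_at z s \<equiv> own R n E w t L z s"

section \<open>Sizes of the numbers in the reduced instance\<close>

lemma finite_E: "finite E"
  using simple by (rule finite_edges)

lemma max_nonneg: "0 \<le> max_number E w t"
  using abs_target_le[OF finite_E, of t w] by linarith

lemma X2: "2 \<le> X"
  using max_nonneg by (simp add: X_def)

lemma X_mono: "i \<le> j \<Longrightarrow> X ^ i \<le> X ^ j"
  using X2 by (intro power_increasing) auto

lemma X_pos: "1 \<le> X ^ i"
  using X2 by simp

lemma input_le: "int n \<le> X" "\<bar>t\<bar> \<le> X" "int L \<le> X" "\<bar>input_mem n E w c\<bar> \<le> X"
proof -
  show "int n \<le> X" using max_nonneg by (simp add: X_def)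
  show "\<bar>t\<bar> \<le> X" using abs_target_le[OF finite_E, of t w] by (simp add: X_def)
  show "int L \<le> X" using floorlog_le[of n] max_nonneg by (simp add: X_def L_def)
  show "\<bar>input_mem n E w c\<bar> \<le> X"
    using abs_input_mem_le[OF finite_E, of w t X] X2 by (simp add: X_def)
qed

lemma yes_iff: "(\<exists>z\<in>{1..zmax}. yes z) \<longleftrightarrow> exact_weight ({..<k}, E1) ({..<n}, E) w t"
proof -
  have w0: "exact_weight ({..<k}, E1) ({..<n}, E) w t = exact_weight ({..<k}, E1) ({..<n}, E) w0 t"
    by (intro exact_weight_cong) (simp add: w0_def)
  have L: "n \<le> 2 ^ L" unfolding L_def by (rule le_2_power_floorlog)
  show ?thesis
    unfolding w0
  proof
    assume "\<exists>z\<in>{1..zmax}. yes z"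
    then obtain z where z: "1 \<le> z" "z \<le> zmax" "yes z" by auto
    then have "k \<le> n" by (auto simp: zmax_def split: if_splits)
    then show "exact_weight ({..<k}, E1) ({..<n}, E) w0 t"
      using soundness z(3) unfolding yes_def N_def E'_def w'_def t'_def by blast
  next
    assume ex: "exact_weight ({..<k}, E1) ({..<n}, E) w0 t"
    from completeness[OF this L order_refl] obtain z where
      z: "1 \<le> z" "z < (2 * L + 2) ^ Suc (k * k)" "yes z" and "k \<le> n"
      unfolding yes_def N_def E'_def w'_def t'_def by blast
    then show "\<exists>z\<in>{1..zmax}. yes z" by (intro bexI[of _ z]) (auto simp: zmax_def)
  qed
qed

lemma wf_all_exprs: "e \<in> set (all_exprs R) \<Longrightarrow> wf_expr (R + 6) e"
  by (auto simp: all_exprs_def answer_e_def count_e_def load_e_def D_e_def simp del: One_nat_def)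

lemma fits: "bounded_by a s \<Longrightarrow> e \<in> set (all_exprs R) \<Longrightarrow> fits (X ^ b) s e"
  using fits_poly[OF X2 wf_all_exprs _ _ ebound_all_exprs] unfolding bounded_by_def by blast

lemma runs_set:
  "bounded_by a s \<Longrightarrow> e \<in> set (all_exprs R) \<Longrightarrow> r < R + 6 \<Longrightarrow>
    runs (R + 6) (X ^ b) (assign (R + 6) r e) s (cost e + 1) ((fst s)(r := eval s e), snd s)"
  using runs_assign[OF wf_all_exprs fits] by blast

lemma bounded_by_upd: "bounded_by i s \<Longrightarrow> \<bar>v\<bar> \<le> X ^ i \<Longrightarrow> bounded_by i ((fst s)(r := v), snd s)"
  unfolding bounded_by_def by auto

text \<open>A fictitious state in which the expressions of the reduction can be evaluated on small
  registers. Bounds on \<open>zmax\<close>, \<open>N\<close>, \<open>t'\<close> and the new weights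
  then come from \<open>fits_poly\<close>, without estimating any sum.\<close>

definition clean :: "nat \<Rightarrow> int \<Rightarrow> state" where
  "clean z c = ((\<lambda>_. 0)(R := int n, R + 1 := t, R + 2 := int L, R + 3 := int z, R + 5 := c),
     input_mem n E w)"

lemma own_clean: "own_at z (clean z c)"
  by (simp add: own_def clean_def)

lemma bounded_clean:
  assumes "int z \<le> X ^ i" "\<bar>c\<bar> \<le> X ^ i" "1 \<le> i"
  shows "bounded_by i (clean z c)"
proof -
  have X: "X \<le> X ^ i" using X_mono[OF assms(3)] by simp
  have "0 \<le> X ^ i" using X_pos[of i] by linarith
  then show ?thesis
    using assms(1,2) order_trans[OF input_le(1) X] order_trans[OF input_le(2) X]
      order_trans[OF input_le(3) X] order_trans[OF input_le(4) X]
    unfolding bounded_by_def clean_def by auto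
qed

lemma eval_bound:
  "bounded_by i s \<Longrightarrow> wf_expr (R + 6) e \<Longrightarrow> \<bar>eval s e\<bar> \<le> X ^ ebound i e"
  using fits_poly[OF X2, of "R + 6" e s i "ebound i e"] unfolding bounded_by_def by blast

lemma eval_count_e:
  assumes "own_at z s"
  shows "eval s (count_e R) = int zmax"
proof -
  have "1 \<le> (2 * L + 2) ^ Suc (k * k)" by (intro one_le_power) simp
  then have "int ((2 * L + 2) ^ Suc (k * k) - 1) = int (2 * L + 2) ^ Suc (k * k) - 1"
    by (simp only: of_nat_diff of_nat_power of_nat_1)
  then show ?thesis
    unfolding count_e_def zmax_def eval.simps eval_pow_e eval_D_e[OF assms] binop_val.simps
    using assms unfolding own_def by simp
qed

lemma zmax_le: "int zmax \<le> X ^ ebound 1 (count_e R)"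
  using eval_bound[OF bounded_clean[of 0 1 0], of "count_e R"] eval_count_e[OF own_clean]
    wf_all_exprs[of "count_e R"] X2 by (simp add: all_exprs_def)

lemma N_le: "int N \<le> X ^ ebound 1 (size_e R)"
  using eval_bound[OF bounded_clean[of 0 1 0], of "size_e R"] eval_size_e[OF own_clean] X2
  by (simp add: N_def)

lemma t'_le: "\<bar>t'\<bar> \<le> X ^ ebound 1 (tgt_e R)"
  using eval_bound[OF bounded_clean[of 0 1 0], of "tgt_e R"] eval_tgt_e[OF own_clean] X2
  by (simp add: t'_def)

text \<open>The exponent is \<open>Suc d\<close> because for d = 0 the bound would be 1, while the
  simulation needs the input numbers themselves to be within it. By \<open>exec_mono\<close> the
  larger words do no harm.\<close>

definition "BQ z = (int N + max_number (E' z) w' t' + 2) ^ Suc d"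

lemma simple_E': "simple_graph ({..<N}, E' z)"
  unfolding N_def E'_def by (rule simple_newE)

lemma BQ_le:
  assumes "z \<le> zmax"
  shows "BQ z \<le> X ^ a"
proof -
  let ?i = "address_exp R"
  have w'_le: "\<bar>w' e\<bar> \<le> X ^ ebound ?i (virtual_e R)" if e: "e \<in> E' z" for e
  proof -
    obtain p q where pq: "e = {p, q}" "p < q" "q < N"
      using e unfolding E'_def newE_def N_def by blast
    \<comment> \<open>The address of the weight of e: the weight is the value of
      \<open>virtual_e\<close> there, hence bounded by its \<open>ebound\<close>.\<close>
    define c where "c = 2 * (int p * int N + int q) + 1"
    have "p * N + q < N * N" using block_less[of p N q N 0] pq by simp
    then have "int p * int N + int q < int N * int N"
      by (metis of_nat_add of_nat_less_iff of_nat_mult)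
    moreover have "2 * u + 1 \<le> 2 * v" if "u < v" for u v :: int using that by simp
    ultimately have "c \<le> 2 * (int N * int N)" unfolding c_def by blast
    also have "\<dots> \<le> X * (X ^ ebound 1 (size_e R) * X ^ ebound 1 (size_e R))"
      using N_le X2 by (intro mult_mono) auto
    also have "\<dots> = X ^ (1 + 2 * ebound 1 (size_e R))" by (simp add: power_add mult_2)
    also have "\<dots> \<le> X ^ ?i" by (intro X_mono) (simp add: address_exp_def)
    finally have "\<bar>c\<bar> \<le> X ^ ?i" by (simp add: c_def)
    moreover have "int z \<le> X ^ ?i"
      using assms zmax_le X_mono[of "ebound 1 (count_e R)" ?i] by (simp add: address_exp_def)
    ultimately have "bounded_by ?i (clean z c)" by (intro bounded_clean) (auto simp: address_exp_def)
    from eval_bound[OF this wf_virtual_e]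
    have "\<bar>input_mem N (E' z) w' c\<bar> \<le> X ^ ebound ?i (virtual_e R)"
      unfolding eval_virtual_e[OF own_clean] by (simp add: N_def E'_def w'_def w0_def clean_def)
    moreover have "input_mem N (E' z) w' c = w' e"
      using input_mem_cell(2)[of p N q] pq e by (simp add: c_def)
    ultimately show ?thesis by simp
  qed
  have "max_number (E' z) w' t' \<le> X ^ ebound ?i (virtual_e R) + X ^ ebound 1 (tgt_e R)"
    unfolding max_number_def
  proof (rule Max.boundedI)
    fix x assume "x \<in> insert \<bar>t'\<bar> ((\<lambda>e. \<bar>w' e\<bar>) ` E' z)"
    then show "x \<le> X ^ ebound ?i (virtual_e R) + X ^ ebound 1 (tgt_e R)"
      using t'_le w'_le X_pos[of "ebound ?i (virtual_e R)"] X_pos[of "ebound 1 (tgt_e R)"] by force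
  qed (use finite_edges[OF simple_E'] in auto)
  \<comment> \<open>Two of the three spare powers in \<open>number_exp\<close> absorb four summands
    through 4 \<le> X * X, and the third gives 2 \<le> X ^ i.\<close>
  moreover define i where "i = number_exp R - 2"
  have i: "ebound 1 (size_e R) \<le> i" "ebound ?i (virtual_e R) \<le> i" "ebound 1 (tgt_e R) \<le> i" "1 \<le> i"
    "number_exp R = Suc (Suc i)"
    by (auto simp: i_def number_exp_def)
  have "2 \<le> X ^ i" using X_mono[OF i(4)] X2 by simp
  ultimately have "int N + max_number (E' z) w' t' + 2 \<le> 4 * X ^ i"
    using N_le X_mono[OF i(1)] X_mono[OF i(2)] X_mono[OF i(3)] by linarith
  also have "\<dots> \<le> (X * X) * X ^ i"
  proof (intro mult_right_mono)
    show "4 \<le> X * X" using mult_mono[of 2 X 2 X] X2 by simp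
  qed (use X_pos[of i] in simp)
  also have "\<dots> = X ^ number_exp R" using i(5) by simp
  finally have "BQ z \<le> (X ^ number_exp R) ^ Suc d"
    unfolding BQ_def using abs_target_le[OF finite_edges[OF simple_E'], of t' z w']
    by (intro power_mono) auto
  also have "\<dots> \<le> X ^ a" unfolding power_mult[symmetric] reg_exp_def by (intro X_mono) simp
  finally show ?thesis .
qed

end

section \<open>The program and its running time\<close>

context reduction_run
begin

lemma own_fun_upd: "own_at z s \<Longrightarrow> r < R \<or> r > R + 3 \<Longrightarrow> own_at z ((fst s)(r := v), snd s)"
  unfolding own_def by auto

lemma own_z: "own_at z s \<Longrightarrow> fst s (R + 3) = int z"
  unfolding own_def by blast

section \<open>One instance, and the loop over all instances\<close>

definition ival :: "nat \<Rightarrow> int" where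
  "ival r = ((\<lambda>_. 0)(0 := int N, 1 := t')) r"

lemma eval_init_e: "own_at z s \<Longrightarrow> eval s (init_e R r) = ival r"
  by (auto simp: init_e_def ival_def eval_size_e eval_tgt_e N_def t'_def)

lemma init_e_mem: "init_e R r \<in> set (all_exprs R)"
  by (simp add: init_e_def all_exprs_def)

lemma runs_init:
  assumes "own_at z s" "bounded_by a s" "r \<le> R"
  defines "s' \<equiv> (\<lambda>q. if q < r then ival q else if q = R + 5 then 0 else fst s q, snd s)"
  shows "runs (R + 6) (X ^ b) (init R r) s (2 + (\<Sum>q<r. cost (init_e R q) + 1)) s' \<and>
     own_at z s' \<and> bounded_by a s'"
  using assms(3) unfolding s'_def
proof (induction r)
  case 0
  have "runs (R + 6) (X ^ b) (assign (R + 6) (R + 5) (Num 0)) s 2 ((fst s)(R + 5 := 0), snd s)"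
    using runs_set[OF assms(2), of "Num 0" "R + 5"] by (simp add: all_exprs_def numeral_2_eq_2)
  moreover have "(fst s)(R + 5 := 0) = (\<lambda>q. if q < 0 then ival q else if q = R + 5 then 0 else fst s q)"
    by auto
  moreover have "bounded_by a ((fst s)(R + 5 := 0), snd s)"
    using bounded_by_upd[OF assms(2), of 0] X2 by simp
  ultimately show ?case using own_fun_upd[OF assms(1), of "R + 5" 0] by simp
next
  case (Suc r)
  let ?s = "(\<lambda>q. if q < r then ival q else if q = R + 5 then 0 else fst s q, snd s)"
  have IH: "runs (R + 6) (X ^ b) (init R r) s (2 + (\<Sum>q<r. cost (init_e R q) + 1)) ?s"
    "own_at z ?s" "bounded_by a ?s"
    using Suc by auto
  have ev: "eval ?s (init_e R r) = ival r" using eval_init_e[OF IH(2)] .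
  have eq: "(fst ?s)(r := ival r) = (\<lambda>q. if q < Suc r then ival q else if q = R + 5 then 0 else fst s q)"
    using Suc.prems by (auto simp: fun_eq_iff less_Suc_eq)
  have "\<bar>ival r\<bar> \<le> X ^ a"
  proof -
    have "reg_exp R d \<ge> ebound 1 (size_e R)" "reg_exp R d \<ge> ebound 1 (tgt_e R)"
      by (auto simp: reg_exp_def address_exp_def number_exp_def)
    then show ?thesis
      using order_trans[OF N_le X_mono] order_trans[OF t'_le X_mono] X_pos[of a] by (auto simp: ival_def)
  qed
  then have "bounded_by a ((fst ?s)(r := ival r), snd ?s)" by (intro bounded_by_upd[OF IH(3)])
  moreover have "own_at z ((fst ?s)(r := ival r), snd ?s)" using own_fun_upd[OF IH(2)] Suc.prems by simp
  moreover have "runs (R + 6) (X ^ b) (init R (Suc r)) s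
     (2 + (\<Sum>q<r. cost (init_e R q) + 1) + (cost (init_e R r) + 1)) ((fst ?s)(r := ival r), snd ?s)"
    using runs_Seq[OF IH(1) runs_set[OF IH(3) init_e_mem, of r r]] Suc.prems ev by simp
  ultimately show ?case unfolding eq by (simp add: add_ac)
qed

text \<open>The inequality is strict: before instance z no cell carries the stamp z. Afterwards
  stamps are 0 or at least z, thus ready for z - 1.\<close>

definition "ready z s \<longleftrightarrow> own_at z s \<and> bounded_by a s \<and>
   (\<forall>c. snd s (loc c - 1) = 0 \<or> snd s (loc c - 1) > int z)"

lemma runs_body:
  assumes ready: "ready z s" and z: "1 \<le> z" "z \<le> zmax"
  shows "\<exists>s'. runs (R + 6) (X ^ b) (body R P) s (body_cost R (Tf N)) s' \<and> ready (z - 1) s' \<and>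
     fst s' (R + 4) = (if yes z then 1 else fst s (R + 4))"
proof -
  define s1 where "s1 = (\<lambda>q. if q < R then ival q else if q = R + 5 then 0 else fst s q, snd s)"
  have own: "own_at z s" and bd: "bounded_by a s" using ready unfolding ready_def by auto
  have 1: "runs (R + 6) (X ^ b) (init R R) s (init_cost R) s1" "own_at z s1" "bounded_by a s1"
    using runs_init[OF own bd order_refl] unfolding s1_def init_cost_def by auto
  define vin where "vin = input_mem N (E' z) w'"
  interpret simulation R "R + 5" "R + 3" "R + 6" a b "virtual_e R" "BQ z" X "fst s1" "input_mem n E w" vin
  proof
    show "a \<le> b" by (simp add: word_exp_def)
    show "ebound a (load_e (R + 5) (R + 3) (virtual_e R)) \<le> b" "ebound a (tag_e (R + 5)) \<le> b"
      by (intro ebound_all_exprs; simp add: all_exprs_def)+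
    show "eval (\<rho>, \<mu>) (virtual_e R) = vin (\<rho> (R + 5))"
      if "\<And>r. R \<le> r \<Longrightarrow> r < R + 6 \<Longrightarrow> r \<noteq> R + 5 \<Longrightarrow> \<rho> r = fst s1 r"
        "\<And>c. c \<ge> 0 \<Longrightarrow> \<mu> c = input_mem n E w c" for \<rho> \<mu>
    proof -
      have "own_at z (\<rho>, \<mu>)" using 1(2) that unfolding own_def by simp
      from eval_virtual_e[OF this] show ?thesis
        by (simp add: vin_def N_def E'_def w'_def w0_def)
    qed
  qed (use X2 BQ_le[OF z(2)] 1(3) in \<open>auto simp: bounded_by_def\<close>)
  obtain k s' where ex: "exec ((int N + max_number (E' z) w' t' + 2) ^ d) P (input_state N (E' z) w' t') k s'"
    and k: "k \<le> Tf N" and s': "fst s' 0 > 0 \<longleftrightarrow> yes z"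
    using solves simple_E'[of z] unfolding solves_exact_weight_def yes_def by blast
  have base1: "1 \<le> int N + max_number (E' z) w' t' + 2"
    using abs_target_le[OF finite_edges[OF simple_E'], of t' z w'] by linarith
  then have ex': "exec (BQ z) P (input_state N (E' z) w' t') k s'"
    unfolding BQ_def by (intro exec_mono[OF ex] power_increasing) auto
  have le_BQ: "int N + max_number (E' z) w' t' + 2 \<le> BQ z"
    unfolding BQ_def by (rule self_le_power[OF base1]) simp
  have tag: "fst s1 (R + 3) = int z" using 1(2) by (rule own_z)
  have "mem_rel vin (snd s1)"
    unfolding mem_rel_def
  proof (intro conjI allI impI)
    fix c
    have "max_number (E' z) w' t' \<le> BQ z" "1 \<le> BQ z"
      using le_BQ base1 abs_target_le[OF finite_edges[OF simple_E'], of t' z w'] by linarith+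
    then show "\<bar>vin c\<bar> \<le> BQ z"
      unfolding vin_def by (rule abs_input_mem_le[OF finite_edges[OF simple_E']])
    show "\<bar>snd s1 c\<bar> \<le> X ^ a" using 1(3) by (simp add: bounded_by_def)
    show "snd s1 c = input_mem n E w c" if "c \<ge> 0" using 1(2) that unfolding own_def by blast
    \<comment> \<open>As z \<ge> 1, neither 0 nor a larger stamp equals z, so the simulated memory
      shows exactly the input of the instance.\<close>
    have *: "snd s1 (loc c - 1) = 0 \<or> snd s1 (loc c - 1) > int z"
      using ready by (simp add: ready_def s1_def)
    then show "snd s1 (loc c - 1) = 0 \<or> fst s1 (R + 3) \<le> snd s1 (loc c - 1)" using tag by auto
    show "vin c = (if snd s1 (loc c - 1) = fst s1 (R + 3) then snd s1 (loc c) else vin c)"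
      using * tag z(1) by auto
  qed
  moreover have "\<bar>ival r\<bar> \<le> BQ z" for r
    using le_BQ base1 abs_target_le[OF finite_edges[OF simple_E'], of t' z w'] by (auto simp: ival_def)
  moreover have "\<bar>fst s1 (R + 5)\<bar> \<le> X ^ a" using 1(3) by (simp add: bounded_by_def)
  ultimately have "rel (input_state N (E' z) w' t') s1"
    unfolding rel_def by (simp add: input_state_def s1_def ival_def flip: vin_def)
  from sim[OF ex' below this] obtain s2 where
    s2: "runs (R + 6) (X ^ b) (sim (R + 6) (R + 5) (R + 3) (virtual_e R) P) s1 (slow * k) s2" "rel s' s2"
    by blast
  have bd2: "bounded_by a s2"
    using rel_regs[OF s2(2)] s2(2) unfolding bounded_by_def rel_def mem_rel_def by blast
  have own2: "own_at z s2"
    using s2(2) 1(2) unfolding own_def rel_def mem_rel_def by simp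
  have tag2: "\<forall>c. snd s2 (loc c - 1) = 0 \<or> snd s2 (loc c - 1) \<ge> int z"
    using s2(2) tag unfolding rel_def mem_rel_def by auto
  have ans2: "eval s2 (answer_e R) = (if yes z then 1 else fst s (R + 4))"
    using s2(2) s' R unfolding rel_def by (simp add: answer_e_def s1_def)
  define s3 where "s3 = ((fst s2)(R + 4 := eval s2 (answer_e R)), snd s2)"
  have 3: "runs (R + 6) (X ^ b) (assign (R + 6) (R + 4) (answer_e R)) s2 (cost (answer_e R) + 1) s3"
    unfolding s3_def by (intro runs_set[OF bd2]) (auto simp: all_exprs_def)
  have "\<bar>eval s2 (answer_e R)\<bar> \<le> X ^ a"
    unfolding ans2 using bd X_pos[of a] by (simp add: bounded_by_def)
  then have bd3: "bounded_by a s3" unfolding s3_def by (intro bounded_by_upd[OF bd2])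
  have own3: "own_at z s3" unfolding s3_def by (intro own_fun_upd[OF own2]) simp
  define s4 where "s4 = ((fst s3)(R + 3 := eval s3 (z_e R \<ominus> Num 1)), snd s3)"
  have ev: "eval s3 (z_e R \<ominus> Num 1) = int (z - 1)" using own_z[OF own3] z(1) by simp
  have "runs (R + 6) (X ^ b) (assign (R + 6) (R + 3) (z_e R \<ominus> Num 1)) s3 (cost (z_e R \<ominus> Num 1) + 1) s4"
    unfolding s4_def by (intro runs_set[OF bd3]) (auto simp: all_exprs_def)
  then have 4: "runs (R + 6) (X ^ b) (assign (R + 6) (R + 3) (z_e R \<ominus> Num 1)) s3 4 s4"
    by (simp add: eval_nat_numeral)
  have "\<bar>fst s2 (R + 3)\<bar> \<le> X ^ a" using bd2 unfolding bounded_by_def by simp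
  then have "int z \<le> X ^ a" unfolding own_z[OF own2] by simp
  then have "\<bar>int (z - 1)\<bar> \<le> X ^ a" using z(1) by linarith
  then have bd4: "bounded_by a s4" unfolding s4_def ev by (intro bounded_by_upd[OF bd3])
  have own4: "own_at (z - 1) s4" using own3 unfolding own_def s4_def ev by simp
  have "ready (z - 1) s4"
    unfolding ready_def using bd4 own4 tag2 z(1) by (auto simp: s4_def s3_def) 
  moreover have "fst s4 (R + 4) = (if yes z then 1 else fst s (R + 4))"
    by (simp add: s4_def s3_def ans2)
  moreover have "runs (R + 6) (X ^ b) (body R P) s (body_cost R (Tf N)) s4"
    unfolding body_def body_cost_def
    using runs_Seq[OF 1(1) runs_Seq[OF runs_mono[OF s2(1)] runs_Seq[OF 3 4]]] k
    by simp
  ultimately show ?thesis by blast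
qed

lemma runs_loop:
  assumes "ready z s" "z \<le> zmax"
  shows "\<exists>s'. runs (R + 6) (X ^ b) (WhilePos (R + 3) (body R P)) s (z * (body_cost R (Tf N) + 1) + 1) s' \<and>
     bounded_by a s' \<and> fst s' (R + 4) = (if \<exists>y\<in>{1..z}. yes y then 1 else fst s (R + 4))"
  using assms
proof (induction z arbitrary: s)
  case 0
  then have "own_at 0 s" "bounded_by a s" unfolding ready_def by blast+
  then have "fst s (R + 3) \<le> 0" "bounded_by a s" using own_z[of 0 s] by auto
  then show ?case
    using runs_WhileFalse[of "R + 3" "R + 6" s "X ^ b" "body R P"] by (intro exI[of _ s]) simp
next
  case (Suc z)
  obtain s1 where s1: "runs (R + 6) (X ^ b) (body R P) s (body_cost R (Tf N)) s1" "ready z s1"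
     "fst s1 (R + 4) = (if yes (Suc z) then 1 else fst s (R + 4))"
    using runs_body[OF Suc.prems(1)] Suc.prems(2) by auto
  obtain s2 where s2: "runs (R + 6) (X ^ b) (WhilePos (R + 3) (body R P)) s1 (z * (body_cost R (Tf N) + 1) + 1) s2"
     "bounded_by a s2" "fst s2 (R + 4) = (if \<exists>y\<in>{1..z}. yes y then 1 else fst s1 (R + 4))"
    using Suc.IH[OF s1(2)] Suc.prems(2) by auto
  have "own_at (Suc z) s" using Suc.prems(1) unfolding ready_def by blast
  then have "fst s (R + 3) > 0" using own_z by simp
  then have "runs (R + 6) (X ^ b) (WhilePos (R + 3) (body R P)) s
      (body_cost R (Tf N) + (z * (body_cost R (Tf N) + 1) + 1) + 1) s2"
    using runs_WhileTrue[OF _ _ s1(1) s2(1)] by simp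
  moreover have "body_cost R (Tf N) + (z * (body_cost R (Tf N) + 1) + 1) + 1 = Suc z * (body_cost R (Tf N) + 1) + 1"
    by simp
  moreover have "(\<exists>y\<in>{1..Suc z}. yes y) \<longleftrightarrow> yes (Suc z) \<or> (\<exists>y\<in>{1..z}. yes y)"
    by (simp add: atLeastAtMostSuc_conv)
  then have "fst s2 (R + 4) = (if \<exists>y\<in>{1..Suc z}. yes y then 1 else fst s (R + 4))"
    using s2(3) s1(3) by auto
  ultimately show ?case using s2(2) by metis
qed

text \<open>The sum of l and \<open>floorlog 2 v\<close> is invariant; its bound n keeps the counter
  within a word. A round costs 8 for the two assignments and 1 for the test.\<close>

lemma runs_log:
  assumes "bounded_by a s" "fst s (R + 3) = int v" "fst s (R + 2) = int l" "v \<le> n" "l + floorlog 2 v \<le> n"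
  shows "runs (R + 6) (X ^ b) (WhilePos (R + 3) (log_body R)) s (floorlog 2 v * 9 + 1)
     ((fst s)(R + 2 := int (l + floorlog 2 v), R + 3 := 0), snd s)"
  using assms
proof (induction v arbitrary: s l rule: less_induct)
  case (less v)
  show ?case
  proof (cases "v = 0")
    case True
    have "((fst s)(R + 2 := int (l + floorlog 2 v), R + 3 := 0), snd s) = s"
      using less.prems True by (auto simp: prod_eq_iff fun_eq_iff floorlog_def)
    moreover have "runs (R + 6) (X ^ b) (WhilePos (R + 3) (log_body R)) s (floorlog 2 v * 9 + 1) s"
      using runs_WhileFalse[of "R + 3" "R + 6" s "X ^ b" "log_body R"] less.prems True
      by (simp add: floorlog_def)
    ultimately show ?thesis by (simp only:)
  next
    case False
    have fl: "floorlog 2 v = floorlog 2 (v div 2) + 1" using False by (simp add: compute_floorlog)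
    have nX: "int i \<le> X ^ a" if "i \<le> n" for i
      using that input_le(1) X_mono[of 1 a] by (simp add: reg_exp_def address_exp_def)
    define s1 where "s1 = ((fst s)(R + 2 := eval s (L_e R \<oplus> Num 1)), snd s)"
    have ev1: "eval s (L_e R \<oplus> Num 1) = int (l + 1)" using less.prems(3) by simp
    have 1: "runs (R + 6) (X ^ b) (assign (R + 6) (R + 2) (L_e R \<oplus> Num 1)) s (cost (L_e R \<oplus> Num 1) + 1) s1"
      unfolding s1_def by (intro runs_set[OF less.prems(1)]) (auto simp: all_exprs_def)
    have bd1: "bounded_by a s1"
      unfolding s1_def ev1 using less.prems(1,5) fl nX[of "l + 1"] by (intro bounded_by_upd) auto
    define s2 where "s2 = ((fst s1)(R + 3 := eval s1 (z_e R \<oslash> Num 2)), snd s1)"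
    have ev2: "eval s1 (z_e R \<oslash> Num 2) = int (v div 2)" using less.prems(2) by (simp add: s1_def zdiv_int)
    have 2: "runs (R + 6) (X ^ b) (assign (R + 6) (R + 3) (z_e R \<oslash> Num 2)) s1 (cost (z_e R \<oslash> Num 2) + 1) s2"
      unfolding s2_def by (intro runs_set[OF bd1]) (auto simp: all_exprs_def)
    have bd2: "bounded_by a s2"
      unfolding s2_def ev2 using bd1 less.prems(4) nX[of "v div 2"] by (intro bounded_by_upd) auto
    have regs: "fst s2 (R + 3) = int (v div 2)" "fst s2 (R + 2) = int (l + 1)"
      unfolding s2_def ev2 unfolding s1_def ev1 by simp_all
    have 3: "runs (R + 6) (X ^ b) (WhilePos (R + 3) (log_body R)) s2 (floorlog 2 (v div 2) * 9 + 1)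
       ((fst s2)(R + 2 := int (l + 1 + floorlog 2 (v div 2)), R + 3 := 0), snd s2)"
      by (rule less.IH[OF _ bd2 regs]) (use less.prems(4,5) fl False in auto)
    have 12: "runs (R + 6) (X ^ b) (log_body R) s 8 s2"
      unfolding log_body_def using runs_Seq[OF 1 2] by (simp add: eval_nat_numeral)
    have st: "((fst s2)(R + 2 := int (l + 1 + floorlog 2 (v div 2)), R + 3 := 0), snd s2) =
        ((fst s)(R + 2 := int (l + floorlog 2 v), R + 3 := 0), snd s)"
      unfolding s2_def s1_def fl by (auto simp: fun_eq_iff)
    have W: "runs (R + 6) (X ^ b) (WhilePos (R + 3) (log_body R)) s
        (8 + (floorlog 2 (v div 2) * 9 + 1) + 1)
        ((fst s2)(R + 2 := int (l + 1 + floorlog 2 (v div 2)), R + 3 := 0), snd s2)"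
      by (rule runs_WhileTrue[OF _ _ 12 3]) (use less.prems(2) False in auto)
    have c: "8 + (floorlog 2 (v div 2) * 9 + 1) + 1 \<le> floorlog 2 v * 9 + 1" using fl by simp
    show ?thesis using runs_mono[OF W c] unfolding st .
  qed
qed

section \<open>The whole program and its time\<close>

lemma runs_set':
  "bounded_by a (\<rho>, \<mu>) \<Longrightarrow> e \<in> set (all_exprs R) \<Longrightarrow> r < R + 6 \<Longrightarrow> eval (\<rho>, \<mu>) e = v \<Longrightarrow>
    cost e + 1 = c \<Longrightarrow> runs (R + 6) (X ^ b) (assign (R + 6) r e) (\<rho>, \<mu>) c (\<rho>(r := v), \<mu>)"
  using runs_set[of "(\<rho>, \<mu>)" e r] by auto

definition "time = 11 + L * 9 + cost (count_e R) + zmax * (body_cost R (Tf N) + 1)"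

lemma runs_main:
  "\<exists>s. runs (R + 6) (X ^ b) (main R P) (input_state n E w t) time s \<and>
     (fst s 0 > 0 \<longleftrightarrow> exact_weight ({..<k}, E1) ({..<n}, E) w t)"
proof -
  define \<mu> where "\<mu> = input_mem n E w"
  have a1: "1 \<le> a" by (simp add: reg_exp_def address_exp_def)
  have Xa: "X \<le> X ^ a" using X_mono[OF a1] by simp
  have X0: "0 \<le> X ^ a" using X_pos[of a] by linarith
  note le = order_trans[OF input_le(1) Xa] order_trans[OF input_le(2) Xa]
    order_trans[OF input_le(3) Xa] order_trans[OF input_le(4) Xa]
  define \<rho>0 where "\<rho>0 = (\<lambda>_ :: nat. 0 :: int)(0 := int n, 1 := t)"
  have s0: "input_state n E w t = (\<rho>0, \<mu>)" by (simp add: input_state_def \<rho>0_def \<mu>_def)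
  have b0: "bounded_by a (\<rho>0, \<mu>)" unfolding bounded_by_def \<rho>0_def \<mu>_def using le X0 by auto
  have Rs: "0 < R" "1 < R" using R by auto
  define \<rho>1 where "\<rho>1 = \<rho>0(R := int n)"
  have 1: "runs (R + 6) (X ^ b) (assign (R + 6) R (Var 0)) (\<rho>0, \<mu>) 2 (\<rho>1, \<mu>)"
    unfolding \<rho>1_def by (rule runs_set'[OF b0]) (simp_all add: all_exprs_def \<rho>0_def)
  have b1: "bounded_by a (\<rho>1, \<mu>)" using bounded_by_upd[OF b0, of "int n" R] le by (simp add: \<rho>1_def)
  define \<rho>2 where "\<rho>2 = \<rho>1(R + 1 := t)"
  have 2: "runs (R + 6) (X ^ b) (assign (R + 6) (R + 1) (Var 1)) (\<rho>1, \<mu>) 2 (\<rho>2, \<mu>)"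
    unfolding \<rho>2_def using Rs by (intro runs_set'[OF b1]) (simp_all add: all_exprs_def \<rho>1_def \<rho>0_def)
  have b2: "bounded_by a (\<rho>2, \<mu>)" using bounded_by_upd[OF b1, of t "R + 1"] le by (simp add: \<rho>2_def)
  define \<rho>3 where "\<rho>3 = \<rho>2(R + 3 := int n)"
  have 3: "runs (R + 6) (X ^ b) (assign (R + 6) (R + 3) (Var 0)) (\<rho>2, \<mu>) 2 (\<rho>3, \<mu>)"
    unfolding \<rho>3_def using Rs
    by (intro runs_set'[OF b2]) (simp_all add: all_exprs_def \<rho>2_def \<rho>1_def \<rho>0_def)
  have b3: "bounded_by a (\<rho>3, \<mu>)" using bounded_by_upd[OF b2, of "int n" "R + 3"] le by (simp add: \<rho>3_def)
  define \<rho>4 where "\<rho>4 = \<rho>3(R + 2 := int L, R + 3 := 0)"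
  have "\<rho>3 (R + 2) = 0" using Rs by (simp add: \<rho>3_def \<rho>2_def \<rho>1_def \<rho>0_def)
  then have 4: "runs (R + 6) (X ^ b) (WhilePos (R + 3) (log_body R)) (\<rho>3, \<mu>) (L * 9 + 1) (\<rho>4, \<mu>)"
    using runs_log[OF b3, of n 0] floorlog_le[of n] by (simp add: \<rho>4_def \<rho>3_def L_def)
  have b4: "bounded_by a (\<rho>4, \<mu>)"
    using bounded_by_upd[OF bounded_by_upd[OF b3, of "int L" "R + 2"], of 0 "R + 3"] le X0 by (simp add: \<rho>4_def)
  have own4: "own_at 0 (\<rho>4, \<mu>)" unfolding own_def by (simp add: \<rho>4_def \<rho>3_def \<rho>2_def \<rho>1_def \<mu>_def)
  define \<rho>5 where "\<rho>5 = \<rho>4(R + 3 := int zmax)"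
  have 5: "runs (R + 6) (X ^ b) (assign (R + 6) (R + 3) (count_e R)) (\<rho>4, \<mu>) (cost (count_e R) + 1) (\<rho>5, \<mu>)"
    unfolding \<rho>5_def by (intro runs_set'[OF b4] eval_count_e[OF own4]) (simp_all add: all_exprs_def)
  have "int zmax \<le> X ^ a"
    using zmax_le X_mono[of "ebound 1 (count_e R)" a] by (simp add: reg_exp_def address_exp_def)
  then have b5: "bounded_by a (\<rho>5, \<mu>)" using bounded_by_upd[OF b4, of "int zmax" "R + 3"] by (simp add: \<rho>5_def)
  have own5: "own_at zmax (\<rho>5, \<mu>)" using own4 unfolding own_def by (simp add: \<rho>5_def)
  \<comment> \<open>The input leaves negative addresses at 0, so initially every stamp is 0.\<close>
  have "\<mu> (loc c - 1) = 0" for c using loc_neg(2)[of c] by (simp add: \<mu>_def input_mem_def Let_def)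
  then have "ready zmax (\<rho>5, \<mu>)" unfolding ready_def using own5 b5 by simp
  from runs_loop[OF this order_refl] obtain s6 where
    6: "runs (R + 6) (X ^ b) (WhilePos (R + 3) (body R P)) (\<rho>5, \<mu>) (zmax * (body_cost R (Tf N) + 1) + 1) s6"
    and b6: "bounded_by a s6" and
    ans: "fst s6 (R + 4) = (if \<exists>y\<in>{1..zmax}. yes y then 1 else \<rho>5 (R + 4))"
    by auto
  have "\<rho>5 (R + 4) = 0" using Rs by (simp add: \<rho>5_def \<rho>4_def \<rho>3_def \<rho>2_def \<rho>1_def \<rho>0_def)
  then have "fst s6 (R + 4) > 0 \<longleftrightarrow> exact_weight ({..<k}, E1) ({..<n}, E) w t"
    using ans yes_iff by auto
  moreover have 7: "runs (R + 6) (X ^ b) (assign (R + 6) 0 (Var (R + 4))) s6 2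
      ((fst s6)(0 := fst s6 (R + 4)), snd s6)"
    using runs_set[OF b6, of "Var (R + 4)" 0] by (simp add: all_exprs_def numeral_2_eq_2)
  moreover have "runs (R + 6) (X ^ b) (main R P) (input_state n E w t) time
      ((fst s6)(0 := fst s6 (R + 4)), snd s6)"
    unfolding main_def s0
    using runs_Seq[OF 1 runs_Seq[OF 2 runs_Seq[OF 3 runs_Seq[OF 4 runs_Seq[OF 5 runs_Seq[OF 6 7]]]]]]
    by (rule runs_mono) (simp add: time_def)
  ultimately show ?thesis by (intro exI conjI) auto
qed

lemma time_le:
  "time \<le> (26 + cost (count_e R) + init_cost R + cost (answer_e R) +
    simulation.slow (R + 5) (R + 3) (virtual_e R)) * (2 * L + 2) ^ Suc (k * k) * (Tf N + 1)"
proof -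
  define Z where "Z = (2 * L + 2) ^ Suc (k * k)"
  define U where "U = 26 + cost (count_e R) + init_cost R + cost (answer_e R) +
    simulation.slow (R + 5) (R + 3) (virtual_e R)"
  have "2 * L + 2 \<le> Z" unfolding Z_def by (rule self_le_power) auto
  moreover have "zmax \<le> Z" by (simp add: zmax_def Z_def)
  ultimately have "11 * 1 + L * 9 + cost (count_e R) * 1 + zmax * (body_cost R (Tf N) + 1) \<le>
      11 * Z + Z * 9 + cost (count_e R) * Z + Z * (body_cost R (Tf N) + 1)"
    by (intro add_mono mult_mono) auto
  also have "\<dots> = Z * (20 + cost (count_e R) + body_cost R (Tf N) + 1)" by (simp add: algebra_simps)
  also have "\<dots> \<le> Z * (U * (Tf N + 1))"
  proof (rule mult_le_mono2)
    \<comment> \<open>The 26 consists of 20 for the set-up and the bit count, 5 for the two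
      assignments after the simulation and 1 for the loop test.\<close>
    have "20 + cost (count_e R) + body_cost R (Tf N) + 1 =
        (U - simulation.slow (R + 5) (R + 3) (virtual_e R)) + simulation.slow (R + 5) (R + 3) (virtual_e R) * Tf N"
      by (simp add: U_def body_cost_def)
    also have "\<dots> \<le> U + U * Tf N"
      by (intro add_mono mult_le_mono1) (auto simp: U_def)
    finally show "20 + cost (count_e R) + body_cost R (Tf N) + 1 \<le> U * (Tf N + 1)" by simp
  qed
  also have "\<dots> = U * Z * (Tf N + 1)" by (simp only: mult_ac)
  finally show ?thesis unfolding time_def U_def[symmetric] Z_def[symmetric] by (simp only: mult_1_right)
qed

end

section \<open>Vertex-minors and conclusion\<close>

lemma (in reduction) solves_E1:
  assumes "solves_exact_weight ({..<h}, E2) P d Tf"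
  shows "\<exists>Q d' c. solves_exact_weight ({..<k}, E1) Q d'
     (\<lambda>n. c * (2 * floorlog 2 n + 2) ^ Suc (k * k) * (Tf ((h + 1) * n) + 1))"
proof -
  obtain R0 where "prog_below R0 P" using ex_prog_below by blast
  then have below: "prog_below (R0 + 2) P" by (rule prog_below_mono) simp
  \<comment> \<open>R, the constant c and the exponent of the word size depend only on the two
    graphs, P and d, so they are fixed before the instance.\<close>
  define R where "R = R0 + 2"
  define c where "c = 26 + cost (count_e R) + init_cost R + cost (answer_e R) +
    simulation.slow (R + 5) (R + 3) (virtual_e R)"
  have "\<exists>j s. exec ((int n + max_number E w t + 2) ^ word_exp R d) (main R P) (input_state n E w t) j s \<and>
      j \<le> c * (2 * floorlog 2 n + 2) ^ Suc (k * k) * (Tf ((h + 1) * n) + 1) \<and>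
      (fst s 0 > 0 \<longleftrightarrow> exact_weight ({..<k}, E1) ({..<n}, E) w t)"
    if "simple_graph ({..<n}, E)" for n E w t
  proof -
    interpret reduction_run k h els \<phi> E1 R P d Tf n E w t
      by unfold_locales (use below assms that in \<open>auto simp: R_def\<close>)
    obtain s where s: "runs (R + 6) (X ^ b) (main R P) (input_state n E w t) time s"
      "fst s 0 > 0 \<longleftrightarrow> exact_weight ({..<k}, E1) ({..<n}, E) w t"
      using runs_main by blast
    then obtain \<rho> j where "exec (X ^ b) (main R P) (input_state n E w t) j (\<rho>, snd s)" "j \<le> time"
      "\<forall>r<R + 6. \<rho> r = fst s r"
      unfolding runs_def by (metis prod.collapse)
    moreover note time_le
    ultimately show ?thesis
      using s(2) unfolding X_def c_def L_def N_def
      by (intro exI[of _ j] exI[of _ "(\<rho>, snd s)"]) auto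
  qed
  then show ?thesis unfolding solves_exact_weight_def by blast
qed

section \<open>Asymptotics of the running time\<close>

lemma floorlog_bigo: "(\<lambda>n. real (2 * floorlog 2 n + 2)) \<in> O(\<lambda>n. ln (real n))"
proof (rule bigoI)
  show "eventually (\<lambda>n. norm (real (2 * floorlog 2 n + 2)) \<le> (2 / ln 2 + 4) * norm (ln (real n))) at_top"
    \<comment> \<open>From 3 on, n exceeds e, and ln n \<ge> 1 absorbs the additive
      constants.\<close>
    using eventually_ge_at_top[of "3::nat"]
  proof eventually_elim
    case (elim n)
    have n: "n > 0" "exp 1 \<le> real n" using elim exp_le by auto
    then have "ln (real n) \<ge> 1" by (simp add: ln_ge_iff)
    have "2 ^ (floorlog 2 n - 1) \<le> n" using n(1) floorlog_bounds[of n 2] by simp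
    then have "(2::real) ^ (floorlog 2 n - 1) \<le> real n" by (metis of_nat_le_iff of_nat_numeral of_nat_power)
    then have "real (floorlog 2 n - 1) * ln 2 \<le> ln (real n)"
      using n(1) by (metis ln_le_cancel_iff ln_realpow of_nat_0_less_iff zero_less_numeral zero_less_power)
    then have "real (floorlog 2 n - 1) \<le> ln (real n) / ln 2" by (simp add: pos_le_divide_eq)
    then have "real (2 * floorlog 2 n + 2) \<le> 2 * (ln (real n) / ln 2) + 4" by linarith
    also have "\<dots> \<le> 2 * (ln (real n) / ln 2) + 4 * ln (real n)" using \<open>ln (real n) \<ge> 1\<close> by simp
    also have "\<dots> = (2 / ln 2 + 4) * ln (real n)" by (simp add: algebra_simps)
    finally show ?case using \<open>ln (real n) \<ge> 1\<close> by simp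
  qed
qed

lemma soft_O_time:
  assumes T: "(\<lambda>n. real (T n)) \<in> O(\<lambda>n. real n powr \<alpha>)" and \<alpha>: "\<alpha> \<ge> 0"
  shows "(\<lambda>n. real (c * (2 * floorlog 2 n + 2) ^ K * (T ((h + 1) * n) + 1))) \<in>
     soft_O (\<lambda>n. real n powr \<alpha>)"
proof -
  have "filterlim (\<lambda>n::nat. (h + 1) * n) at_top at_top"
    by (rule filterlim_at_top_mono[OF filterlim_ident]) simp
  from landau_o.big.compose[OF T this]
  have "(\<lambda>n. real (T ((h + 1) * n))) \<in> O(\<lambda>n. real ((h + 1) * n) powr \<alpha>)" by simp
  also have "(\<lambda>n. real ((h + 1) * n) powr \<alpha>) = (\<lambda>n. real (h + 1) powr \<alpha> * real n powr \<alpha>)"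
    by (rule ext) (simp only: of_nat_mult powr_mult of_nat_0_le_iff)
  also have "\<dots> \<in> O(\<lambda>n. real n powr \<alpha>)" by simp
  finally have "(\<lambda>n. real (T ((h + 1) * n))) \<in> O(\<lambda>n. real n powr \<alpha>)" .
  moreover have "(\<lambda>n::nat. 1 :: real) \<in> O(\<lambda>n. real n powr \<alpha>)"
  proof (rule bigoI)
    show "eventually (\<lambda>n::nat. norm (1::real) \<le> 1 * norm (real n powr \<alpha>)) at_top"
      using eventually_ge_at_top[of 1]
      by eventually_elim (use \<alpha> ge_one_powr_ge_zero in force)
  qed
  ultimately have T1: "(\<lambda>n. real (T ((h + 1) * n) + 1)) \<in> O(\<lambda>n. real n powr \<alpha>)"
    unfolding of_nat_add of_nat_1 by (rule sum_in_bigo)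
  have "(\<lambda>n. real c * real (2 * floorlog 2 n + 2) ^ K) \<in> O(\<lambda>n. ln (real n) ^ K)"
    using landau_o.big_power[OF floorlog_bigo, of K] by (cases "c = 0") auto
  from landau_o.big.mult[OF this T1]
  have "(\<lambda>n. real (c * (2 * floorlog 2 n + 2) ^ K * (T ((h + 1) * n) + 1))) \<in>
     O(\<lambda>n. real n powr \<alpha> * ln (real n) ^ K)"
    unfolding of_nat_mult of_nat_power by (simp only: mult.commute mult.left_commute)
  then show ?thesis unfolding soft_O_def by blast
qed

section \<open>Isomorphism invariance and vertex-minors as coverings\<close>

lemma graph_iso_trans:
  assumes "graph_iso G H" "graph_iso H K"
  shows "graph_iso G K"
proof -
  obtain f where f: "bij_betw f (verts G) (verts H)" "edges H = (\<lambda>e. f ` e) ` edges G"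
    using assms(1) unfolding graph_iso_def by blast
  obtain g where g: "bij_betw g (verts H) (verts K)" "edges K = (\<lambda>e. g ` e) ` edges H"
    using assms(2) unfolding graph_iso_def by blast
  have "edges K = (\<lambda>e. (g \<circ> f) ` e) ` edges G"
    unfolding f(2) g(2) by (simp add: image_image o_def)
  then show ?thesis unfolding graph_iso_def using bij_betw_trans[OF f(1) g(1)] by blast
qed

lemma graph_iso_sym:
  assumes "graph_iso G H" "simple_graph G"
  shows "graph_iso H G"
proof -
  obtain f where f: "bij_betw f (verts G) (verts H)" "edges H = (\<lambda>e. f ` e) ` edges G"
    using assms unfolding graph_iso_def by blast
  have "inv_into (verts G) f ` f ` e = e" if "e \<in> edges G" for e
    using inv_into_image_cancel[OF bij_betw_imp_inj_on[OF f(1)]] assms(2) that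
    unfolding simple_graph_def by blast
  then have "edges G = (\<lambda>e. inv_into (verts G) f ` e) ` edges H"
    unfolding f(2) image_image by simp
  then show ?thesis unfolding graph_iso_def using bij_betw_inv_into[OF f(1)] by blast
qed

lemma solvable_iso:
  assumes "graph_iso H H'" "simple_graph H"
  shows "exact_weight_solvable_in H F \<longleftrightarrow> exact_weight_solvable_in H' F"
proof -
  have "exact_weight H G w t \<longleftrightarrow> exact_weight H' G w t" for G :: "nat graph" and w t
    unfolding exact_weight_def
    using graph_iso_trans[OF _ assms(1)] graph_iso_trans[OF _ graph_iso_sym[OF assms]] by blast
  then show ?thesis unfolding exact_weight_solvable_in_def solves_exact_weight_def by simp
qed

lemma ex_nat_iso:
  assumes "simple_graph H"
  shows "\<exists>\<beta> (n::nat). bij_betw \<beta> (verts H) {..<n} \<and> simple_graph ({..<n}, (\<lambda>e. \<beta> ` e) ` edges H) \<and>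
     graph_iso H ({..<n}, (\<lambda>e. \<beta> ` e) ` edges H)"
proof -
  have fin: "finite (verts H)" and sub: "\<And>e. e \<in> edges H \<Longrightarrow> e \<subseteq> verts H \<and> card e = 2"
    using assms unfolding simple_graph_def by auto
  obtain \<beta> where \<beta>: "bij_betw \<beta> (verts H) {..<card (verts H)}"
    using ex_bij_betw_finite_nat[OF fin] unfolding atLeast0LessThan by blast
  have "card (\<beta> ` e) = 2" "\<beta> ` e \<subseteq> {..<card (verts H)}" if "e \<in> edges H" for e
  proof -
    show "card (\<beta> ` e) = 2"
      using sub[OF that] \<beta> by (metis bij_betw_imp_inj_on card_image inj_on_subset)
    show "\<beta> ` e \<subseteq> {..<card (verts H)}"
      using sub[OF that] \<beta> by (metis bij_betw_imp_surj_on image_mono)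
  qed
  then have "simple_graph ({..<card (verts H)}, (\<lambda>e. \<beta> ` e) ` edges H)"
    unfolding simple_graph_def by auto
  moreover have "graph_iso H ({..<card (verts H)}, (\<lambda>e. \<beta> ` e) ` edges H)"
    unfolding graph_iso_def using \<beta> by auto
  ultimately show ?thesis using \<beta> by blast
qed

text \<open>The reduction sees a vertex-minor only through such a map: nodes are merged, and every
  remaining edge lifts. This composes along a sequence of minor steps.\<close>

definition covers :: "('b \<Rightarrow> 'a) \<Rightarrow> 'b graph \<Rightarrow> 'a graph \<Rightarrow> bool" where
  "covers \<phi> G H \<longleftrightarrow> \<phi> ` verts G = verts H \<and> edges H \<subseteq> (\<lambda>e. \<phi> ` e) ` edges G"

lemma covers_trans:
  assumes "covers \<phi> G H" "covers \<psi> H K"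
  shows "covers (\<psi> \<circ> \<phi>) G K"
  unfolding covers_def
proof
  show "(\<psi> \<circ> \<phi>) ` verts G = verts K"
    using assms unfolding covers_def by (metis image_comp)
  have "edges K \<subseteq> (\<lambda>e. \<psi> ` e) ` (\<lambda>e. \<phi> ` e) ` edges G"
    using assms unfolding covers_def by (meson image_mono order_trans)
  then show "edges K \<subseteq> (\<lambda>e. (\<psi> \<circ> \<phi>) ` e) ` edges G"
    by (simp add: image_image o_def)
qed

lemma graph_iso_covers:
  assumes "graph_iso G H"
  shows "\<exists>\<phi>. covers \<phi> G H"
proof -
  obtain f where "bij_betw f (verts G) (verts H)" "edges H = (\<lambda>e. f ` e) ` edges G"
    using assms unfolding graph_iso_def by blast
  then have "covers f G H" by (simp add: covers_def bij_betw_def)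
  then show ?thesis by blast
qed

text \<open>Deletion is covered by the identity, contraction by the map merging a and b. An edge
  between a and b has a singleton image, which does no harm because only edges of H have to
  lift.\<close>

lemma minor_step_covers:
  assumes "minor_step G H" "simple_graph G"
  shows "simple_graph H \<and> (\<exists>\<phi>. covers \<phi> G H)"
  using assms(1)
proof cases
  case (delete_edge e)
  then have "simple_graph H" "covers id G H"
    using assms(2) by (auto simp: simple_graph_def covers_def)
  then show ?thesis by blast
next
  case (contract_nodes a b c)
  have E: "e \<subseteq> verts G" "card e = 2" if "e \<in> edges G" for e
    using assms(2) that unfolding simple_graph_def by auto
  have nbr: "x \<in> verts G" if "x \<in> neighborhood G v" for x v
    using that E(1)[of "{x, v}"] unfolding neighborhood_def by auto
  define \<phi> where "\<phi> x = (if x \<in> {a, b} then c else x)" for x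
  have "simple_graph H"
    using assms(2) contract_nodes nbr
    unfolding simple_graph_def contract_def by (auto simp: card_insert_if)
  moreover have "covers \<phi> G H"
    unfolding covers_def
  proof
    show "\<phi> ` verts G = verts H"
      using contract_nodes by (auto simp: \<phi>_def contract_def)
    show "edges H \<subseteq> (\<lambda>e. \<phi> ` e) ` edges G"
    proof
      fix e assume "e \<in> edges H"
      then consider "e \<in> edges G" "a \<notin> e" "b \<notin> e"
        | x v where "v \<in> {a, b}" "{x, v} \<in> edges G" "e = {c, x}" "x \<notin> {a, b}"
        using contract_nodes(1) unfolding contract_def neighborhood_def by auto
      then show "e \<in> (\<lambda>e. \<phi> ` e) ` edges G"
      proof cases
        case 1
        then have "\<phi> ` e = e" by (force simp: \<phi>_def)
        then show ?thesis using 1 by (metis imageI)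
      next
        case 2
        then have "\<phi> ` {x, v} = e" by (auto simp: \<phi>_def)
        then show ?thesis using 2 by (metis imageI)
      qed
    qed
  qed
  ultimately show ?thesis by blast
qed

lemma vertex_minor_covers:
  assumes "vertex_minor H1 H2" "simple_graph H2"
  shows "\<exists>\<phi>. covers \<phi> H2 H1"
proof -
  obtain H where H: "minor_step\<^sup>*\<^sup>* H2 H" "graph_iso H H1" using assms(1) unfolding vertex_minor_def by blast
  from H(1) have "simple_graph H \<and> (\<exists>\<phi>. covers \<phi> H2 H)"
  proof (induction rule: rtranclp_induct)
    case base
    have "covers id H2 H2" by (simp add: covers_def)
    then show ?case using assms(2) by blast
  next
    case (step G K)
    then show ?case using minor_step_covers[of G K] covers_trans by blast
  qed
  moreover obtain f where "covers f H H1" using graph_iso_covers[OF H(2)] by blast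
  ultimately show ?thesis using covers_trans by blast
qed

theorem theorem2:
  fixes H1 :: "'a graph" and H2 :: "'b graph" and \<alpha> :: real
  assumes "simple_graph H1" and "simple_graph H2"
    and "vertex_minor H1 H2"
    and "\<alpha> \<ge> 2"
    and "exact_weight_solvable_in H2 (O(\<lambda>n. real n powr \<alpha>))"
  shows "exact_weight_solvable_in H1 (soft_O (\<lambda>n. real n powr \<alpha>))"
proof -
  obtain \<psi> where \<psi>: "covers \<psi> H2 H1" using vertex_minor_covers assms(2,3) by blast
  obtain \<gamma> and k :: nat where \<gamma>: "bij_betw \<gamma> (verts H1) {..<k}"
    "simple_graph ({..<k}, (\<lambda>e. \<gamma> ` e) ` edges H1)" "graph_iso H1 ({..<k}, (\<lambda>e. \<gamma> ` e) ` edges H1)"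
    using ex_nat_iso[OF assms(1)] by blast
  obtain \<beta> and h :: nat where \<beta>: "bij_betw \<beta> (verts H2) {..<h}"
    "simple_graph ({..<h}, (\<lambda>e. \<beta> ` e) ` edges H2)" "graph_iso H2 ({..<h}, (\<lambda>e. \<beta> ` e) ` edges H2)"
    using ex_nat_iso[OF assms(2)] by blast
  define E1 where "E1 = (\<lambda>e. \<gamma> ` e) ` edges H1"
  define E2 where "E2 = (\<lambda>e. \<beta> ` e) ` edges H2"
  have \<gamma>': "covers \<gamma> H1 ({..<k}, E1)" using \<gamma>(1) by (simp add: covers_def E1_def bij_betw_def)
  have "graph_iso ({..<h}, E2) H2" unfolding E2_def using graph_iso_sym[OF \<beta>(3) assms(2)] .
  then obtain \<beta>' where "covers \<beta>' ({..<h}, E2) H2" using graph_iso_covers by blast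
  from covers_trans[OF covers_trans[OF this \<psi>] \<gamma>']
  obtain \<phi> where \<phi>: "covers \<phi> ({..<h}, E2) ({..<k}, E1)" by blast
  \<comment> \<open>Each edge of the numbered H2 is oriented from its smaller to its larger end, as
    the locale demands.\<close>
  define U where "U = {(u, v). u < v \<and> {u, v} \<in> E2}"
  have E2: "e \<subseteq> {..<h}" "card e = 2" if "e \<in> E2" for e
    using \<beta>(2) that unfolding simple_graph_def E2_def by auto
  have U: "u < v" "v < h" if "(u, v) \<in> U" for u v using that E2(1) unfolding U_def by auto
  have "U \<subseteq> {..<h} \<times> {..<h}" using U by force
  then have "finite U" by (rule finite_subset) simp
  then obtain els where els: "set els = U" "distinct els" using finite_distinct_list by blast
  have E2_U: "\<exists>(u, v)\<in>U. e = {u, v}" if e: "e \<in> E2" for e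
  proof -
    obtain x y where xy: "e = {x, y}" "x \<noteq> y" using E2(2)[OF e] by (auto simp: card_2_iff)
    then have "(min x y, max x y) \<in> U" "e = {min x y, max x y}"
      using e by (auto simp: U_def min_def max_def insert_commute)
    then show ?thesis by blast
  qed
  interpret red: reduction k h els \<phi> E1
  proof
    show "\<exists>(u, v)\<in>set els. e = {\<phi> u, \<phi> v}" if e: "e \<in> E1" for e
    proof -
      obtain e2 where "e2 \<in> E2" "e = \<phi> ` e2" using e \<phi> unfolding covers_def by auto
      then show ?thesis using E2_U[of e2] els(1) by auto
    qed
  qed (use els U \<phi> \<gamma>(2) in \<open>auto simp: covers_def E1_def\<close>)
  have "red.E2 = E2"
    unfolding red.E2_def els(1) using E2_U by (auto simp: U_def) blast
  obtain P d T where P: "solves_exact_weight ({..<h}, E2) P d T" "(\<lambda>n. real (T n)) \<in> O(\<lambda>n. real n powr \<alpha>)"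
    using assms(5) solvable_iso[OF \<beta>(3) assms(2)] unfolding E2_def exact_weight_solvable_in_def by blast
  obtain Q d' c where "solves_exact_weight ({..<k}, E1) Q d'
      (\<lambda>n. c * (2 * floorlog 2 n + 2) ^ Suc (k * k) * (T ((h + 1) * n) + 1))"
    using red.solves_E1 P(1) \<open>red.E2 = E2\<close> by blast
  then have "exact_weight_solvable_in ({..<k}, E1) (soft_O (\<lambda>n. real n powr \<alpha>))"
    using soft_O_time[OF P(2)] assms(4) unfolding exact_weight_solvable_in_def by fastforce
  then show ?thesis using solvable_iso[OF \<gamma>(3) assms(1)] unfolding E1_def by blast
qed

end
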